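(* Let $\Lambda$ be a lattice of determinant $1$ in $\mathbb R^n$, let $k$ be a natural number (with $k\ge 2$ if $n=1$), and let $V$ be the set of $k$-free points of $\Lambda$. Then the measure entropy of $V$ vanishes: $$h_{\rm meas}(V)=0.$$
   Context: For a nonzero point $l\in\Lambda$, the $k$-content $c_k(l)$ is the largest integer $c$ such that $l\in c^k\Lambda$; $c_k(0)=\infty$. The set of $k$-free points is $V=\{l\in\Lambda: c_k(l)=1\}$. $B_\rho(x)$ is the open Euclidean ball of radius $\rho$ about $x$, and $v_n$ is the volume of the unit ball in $\mathbb R^n$. For $\rho>0$ and $t\in\Lambda$ the $\rho$-patch of $V$ at $t$ is $(V-t)\cap B_\rho(0)$; $\mathcal A(\rho)$ is the (finite) set of all $\rho$-patches of $V$ as $t$ ranges over $\Lambda$. The density of $Y\subset\Lambda$ is $\delta(Y):=\lim_{R\to\infty}|Y\cap B_R(0)|/(R^nv_n)$ when the limit exists. The frequency of a $\rho$-patch $\mathcal P$ is $\nu(\mathcal P):=\delta(\{t\in\Lambda: (V-t)\cap B_\rho(0)=\mathcal P\})$; for the set $V$ all these densities exist. The measure entropy is $$h_{\rm meas}(V):=\lim_{\rho\to\infty}\frac{1}{\rho^nv_n}\sum_{\mathcal P\in\mathcal A(\rho)}-\nu(\mathcal P)\log_2\nu(\mathcal P),$$ with the convention $\nu\log_2\nu=0$ when $\nu=0$. *)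

theory Defs
  imports "HOL-Analysis.Analysis"
begin

text \<open>The columns of \<open>B\<close> form a \<open>\<int>\<close>-basis of \<open>\<Lambda>\<close> and an \<open>\<real>\<close>-basis of the whole space.\<close>

definition lattice_basis :: "real^'n^'n \<Rightarrow> (real^'n) set \<Rightarrow> bool" where
  "lattice_basis B \<Lambda> \<longleftrightarrow>
     invertible B \<and> \<Lambda> = range (\<lambda>z :: int^'n. B *v (\<chi> i. of_int (z $ i)))"

definition is_lattice :: "(real^'n) set \<Rightarrow> bool" where
  "is_lattice \<Lambda> \<longleftrightarrow> (\<exists>B. lattice_basis B \<Lambda>)"

text \<open>The choice of basis is immaterial, see \<open>lattice_det_eq\<close> below.\<close>

definition lattice_det :: "(real^'n) set \<Rightarrow> real" where
  "lattice_det \<Lambda> = \<bar>det (SOME B. lattice_basis B \<Lambda>)\<bar>"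

lemma lattice_basis_change:
  fixes A B :: "real^'n^'n"
  assumes A: "lattice_basis A \<Lambda>" and B: "lattice_basis B \<Lambda>"
  shows "\<exists>m::int. det B = det A * of_int m"
proof -
  have "\<exists>z :: int^'n. column j B = A *v (\<chi> i. of_int (z $ i))" for j
  proof -
    have "column j B = B *v (\<chi> i. of_int ((axis j 1 :: int^'n) $ i))"
      by (simp add: vec_eq_iff column_def matrix_vector_mult_def axis_def if_distrib
          cong: if_cong)
    then have "column j B \<in> \<Lambda>"
      using B unfolding lattice_basis_def by blast
    then show ?thesis
      using A unfolding lattice_basis_def by blast
  qed
  then obtain z :: "'n \<Rightarrow> int^'n"
    where z: "\<And>j. column j B = A *v (\<chi> i. of_int (z j $ i))" by metis
  define U :: "real^'n^'n" where "U = (\<chi> i j. of_int (z j $ i))"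
  have "B = A ** U"
  proof -
    have "B $ i $ j = (A ** U) $ i $ j" for i j
      using arg_cong[OF z[of j], of "\<lambda>v. v $ i"]
      by (simp add: column_def matrix_vector_mult_def matrix_matrix_mult_def U_def)
    then show ?thesis by (simp add: vec_eq_iff)
  qed
  then have "det B = det A * det U" by (simp add: det_mul)
  moreover have "det U \<in> \<int>"
    unfolding det_def U_def by (intro Ints_sum Ints_mult Ints_prod) auto
  ultimately show ?thesis by (auto elim!: Ints_cases)
qed

lemma lattice_det_eq:
  fixes B :: "real^'n^'n"
  assumes B: "lattice_basis B \<Lambda>"
  shows "lattice_det \<Lambda> = \<bar>det B\<bar>"
proof -
  define A where "A = (SOME B. lattice_basis B \<Lambda>)"
  have A: "lattice_basis A \<Lambda>" unfolding A_def by (rule someI[of _ B]) (rule B)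
  obtain m n :: int where m: "det B = det A * of_int m" and n: "det A = det B * of_int n"
    using lattice_basis_change[OF A B] lattice_basis_change[OF B A] by blast
  have "det B \<noteq> 0"
    using B by (simp add: lattice_basis_def invertible_det_nz)
  moreover have "det B * 1 = det B * of_int (n * m)"
    using m n by (simp add: mult.assoc)
  ultimately have "of_int (n * m) = (1::real)" by (metis mult_left_cancel)
  then have "n * m = 1" by linarith
  then have "\<bar>n\<bar> = 1" by (metis abs_zmult_eq_1 abs_one)
  then have "\<bar>det A\<bar> = \<bar>det B\<bar>"
    using n by (metis abs_mult mult.right_neutral of_int_1 of_int_abs)
  then show ?thesis by (simp add: lattice_det_def A_def)
qed

text \<open>For \<open>k \<ge> 1\<close> and \<open>0 \<noteq> l \<in> \<Lambda>\<close> the set of admissible \<open>c\<close> is finite and contains \<open>1\<close>, so the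
  maximum exists and is positive; \<open>nat\<close> only adapts the type.\<close>

definition k_content :: "nat \<Rightarrow> (real^'n) set \<Rightarrow> real^'n \<Rightarrow> enat" where
  "k_content k \<Lambda> l =
     (if l = 0 then \<infinity> else enat (nat (GREATEST c :: int. l \<in> (*\<^sub>R) (of_int (c ^ k)) ` \<Lambda>)))"

definition k_free_points :: "nat \<Rightarrow> (real^'n) set \<Rightarrow> (real^'n) set" where
  "k_free_points k \<Lambda> = {l \<in> \<Lambda>. k_content k \<Lambda> l = 1}"

definition patch :: "(real^'n) set \<Rightarrow> real \<Rightarrow> real^'n \<Rightarrow> (real^'n) set" where
  "patch V \<rho> t = (\<lambda>v. v - t) ` V \<inter> ball 0 \<rho>"

definition patches :: "(real^'n) set \<Rightarrow> (real^'n) set \<Rightarrow> real \<Rightarrow> (real^'n) set set" where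
  "patches \<Lambda> V \<rho> = patch V \<rho> ` \<Lambda>"

definition has_density :: "(real^'n) set \<Rightarrow> real \<Rightarrow> bool" where
  "has_density Y d \<longleftrightarrow>
     ((\<lambda>R. real (card (Y \<inter> ball 0 R)) / (R ^ CARD('n) * unit_ball_vol (real CARD('n))))
        \<longlongrightarrow> d) at_top"

definition density :: "(real^'n) set \<Rightarrow> real" where
  "density Y = (THE d. has_density Y d)"

definition patch_locations ::
    "(real^'n) set \<Rightarrow> (real^'n) set \<Rightarrow> real \<Rightarrow> (real^'n) set \<Rightarrow> (real^'n) set" where
  "patch_locations \<Lambda> V \<rho> P = {t \<in> \<Lambda>. patch V \<rho> t = P}"

definition patch_frequency ::
    "(real^'n) set \<Rightarrow> (real^'n) set \<Rightarrow> real \<Rightarrow> (real^'n) set \<Rightarrow> real" where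
  "patch_frequency \<Lambda> V \<rho> P = density (patch_locations \<Lambda> V \<rho> P)"

text \<open>The entropy is defined as a relation, so that asserting a value includes the existence of all
  limits involved: the patch frequencies and the limit over \<open>\<rho>\<close>.  For a lattice \<open>\<Lambda>\<close> and
  \<open>V \<subseteq> \<Lambda>\<close> the index set of the sum is finite.  The convention \<open>0 log 0 = 0\<close> holds
  automatically.\<close>

definition has_measure_entropy :: "(real^'n) set \<Rightarrow> (real^'n) set \<Rightarrow> real \<Rightarrow> bool" where
  "has_measure_entropy \<Lambda> V h \<longleftrightarrow>
     (\<forall>\<rho>>0. \<forall>P\<in>patches \<Lambda> V \<rho>. \<exists>d. has_density (patch_locations \<Lambda> V \<rho> P) d) \<and>
     ((\<lambda>\<rho>. 1 / (\<rho> ^ CARD('n) * unit_ball_vol (real CARD('n))) *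
          (\<Sum>P\<in>patches \<Lambda> V \<rho>.
             - patch_frequency \<Lambda> V \<rho> P * log 2 (patch_frequency \<Lambda> V \<rho> P)))
        \<longlongrightarrow> h) at_top"

end

theory Submission imports Defs begin

text \<open>
  Let \<open>V\<^sub>N\<close> be the set of lattice points outside \<open>c\<^sup>k\<Lambda>\<close> for all \<open>2 \<le> c \<le> N\<close>.  It is periodic, so its
  patches have frequencies and its translates by \<open>\<Lambda>\<close> form a finite set \<open>Q\<close>.  The points of \<open>V\<^sub>N\<close> not
  in \<open>V\<close> lie in \<open>c\<^sup>k\<Lambda>\<close> for some \<open>c > N\<close>; as \<open>n k \<ge> 2\<close>, their upper density is
  \<open>O(\<Sum>c>N. 1 / c\<^sup>2) = O(1 / N)\<close>.  Letting \<open>N\<close> grow, the patch frequencies of \<open>V\<close> exist.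

  A patch of \<open>V\<close> at \<open>t\<close> is determined by the translate \<open>V\<^sub>N - t \<in> Q\<close> and the set \<open>S\<close> of points of the ball
  that are missing from it, which has on average \<open>O(m / N)\<close> elements, where \<open>m\<close> is the number of lattice
  points in the ball.  Comparing the frequencies with the subprobability weights
  \<open>\<epsilon>\<^bsup>card S\<^esup> / (card Q (1 + \<epsilon>)\<^bsup>m\<^esup>)\<close> bounds the entropy by
  \<open>ln (1/\<epsilon>) O(m / N) + ln (card Q) + m ln (1 + \<epsilon>) + O(1)\<close>.  Divide by the volume of the ball, let its
  radius tend to infinity, and choose first \<open>\<epsilon>\<close> small and then \<open>N\<close> large.
\<close>

subsection \<open>Lattice points in balls\<close>

text \<open>The quotient whose limit \<open>has_density\<close> takes, named as a function of the
  radius so that limit rules apply to it directly.\<close>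

definition normalized_count :: "(real^'n) set \<Rightarrow> real \<Rightarrow> real" where
  "normalized_count Y R =
     real (card (Y \<inter> ball 0 R)) / (R ^ CARD('n) * unit_ball_vol (real CARD('n)))"

lemma has_density_iff: "has_density Y d \<longleftrightarrow> (normalized_count Y \<longlongrightarrow> d) at_top"
  unfolding has_density_def normalized_count_def[abs_def] ..

lemma normalized_count_nonneg: "R > 0 \<Longrightarrow> normalized_count Y R \<ge> 0"
  unfolding normalized_count_def by simp

lemma has_density_unique: "has_density Y d \<Longrightarrow> has_density Y d' \<Longrightarrow> d = d'"
  unfolding has_density_iff using tendsto_unique trivial_limit_at_top_linorder by blast

lemma density_eq: "has_density Y d \<Longrightarrow> density Y = d"
  unfolding density_def using has_density_unique by blast

definition vec_of_int :: "int^'n \<Rightarrow> real^'n" where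
  "vec_of_int z = (\<chi> i. of_int (z $ i))"

lemma vec_of_int_simps [simp]:
  "vec_of_int 0 = 0"
  "vec_of_int (x + y) = vec_of_int x + vec_of_int y"
  "vec_of_int (x - y) = vec_of_int x - vec_of_int y"
  "vec_of_int (\<chi> i. m * z $ i) = of_int m *\<^sub>R vec_of_int z"
  by (simp_all add: vec_of_int_def vec_eq_iff)

lemma vec_of_int_inject [simp]: "vec_of_int x = vec_of_int y \<longleftrightarrow> x = y"
  by (simp add: vec_of_int_def vec_eq_iff)

lemma finite_bounded_int_vec: "finite {z :: int^'n. \<forall>i. a \<le> z $ i \<and> z $ i \<le> b}"
proof -
  have "{z :: int^'n. \<forall>i. a \<le> z $ i \<and> z $ i \<le> b} \<subseteq> vec_lambda ` (PiE UNIV (\<lambda>_. {a..b}))"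
  proof
    fix z :: "int^'n" assume "z \<in> {z. \<forall>i. a \<le> z $ i \<and> z $ i \<le> b}"
    then have "vec_nth z \<in> PiE UNIV (\<lambda>_. {a..b})" by auto
    then show "z \<in> vec_lambda ` (PiE UNIV (\<lambda>_. {a..b}))"
      by (metis image_eqI vec_nth_inverse)
  qed
  moreover have "finite (PiE (UNIV :: 'n set) (\<lambda>_. {a..b}))" by (intro finite_PiE) auto
  ultimately show ?thesis using finite_surj by blast
qed

text \<open>The inverse matrix maps the translated ball to a bounded set, which confines the integer
  coordinates to a box.\<close>

lemma finite_affine_lattice_ball:
  fixes A :: "real^'n^'n"
  assumes "invertible A"
  shows "finite {z. r + A *v vec_of_int z \<in> ball 0 R}"
proof -
  obtain A' where A': "A' ** A = mat 1" using assms unfolding invertible_def by blast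
  have "bounded ((\<lambda>x. A' *v (x - r)) ` ball 0 R)"
  proof -
    have "(\<lambda>x. A' *v (x - r)) ` ball 0 R = ((*v) (A')) ` ((\<lambda>x. x - r) ` ball 0 R)"
      by (simp add: image_image)
    moreover have "bounded ((\<lambda>x. x - r) ` ball 0 R)"
      by (intro bounded_translation_minus bounded_ball)
    ultimately show ?thesis
      by (simp add: bounded_linear_image matrix_vector_mul_bounded_linear)
  qed
  then obtain b where b: "\<And>x. x \<in> ball 0 R \<Longrightarrow> norm (A' *v (x - r)) \<le> b"
    unfolding bounded_iff by blast
  have "{z. r + A *v vec_of_int z \<in> ball 0 R} \<subseteq> {z. \<forall>i. -\<lceil>b\<rceil> \<le> z $ i \<and> z $ i \<le> \<lceil>b\<rceil>}"
  proof safe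
    fix z i assume z: "r + A *v vec_of_int z \<in> ball 0 R"
    have "A' *v (A *v vec_of_int z) = vec_of_int z"
      using A' by (simp add: matrix_vector_mul_assoc)
    then have "norm (vec_of_int z) \<le> b" using b[OF z] by simp
    then have "\<bar>real_of_int (z $ i)\<bar> \<le> b"
      using component_le_norm_cart[of "vec_of_int z" i] by (simp add: vec_of_int_def)
    then show "-\<lceil>b\<rceil> \<le> z $ i" "z $ i \<le> \<lceil>b\<rceil>" by linarith+
  qed
  then show ?thesis using finite_bounded_int_vec finite_subset by blast
qed

section \<open>Counting affine lattice points by tiling the space\<close>

definition half_open_cube :: "(real^'n) set" where
  "half_open_cube = {u. \<forall>i. 0 \<le> u $ i \<and> u $ i < 1}"

lemma borel_half_open_cube: "(half_open_cube :: (real^'n) set) \<in> sets borel"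
  unfolding half_open_cube_def by measurable

text \<open>Changing the radius of a ball by a constant of either sign does not affect its volume to
  leading order.\<close>

lemma tendsto_shift_ratio_power: "((\<lambda>R::real. ((R + D) / R) ^ n) \<longlongrightarrow> 1) at_top"
proof -
  have "((\<lambda>R::real. 1 + D * inverse R) \<longlongrightarrow> 1 + D * 0) at_top"
    by (intro tendsto_intros tendsto_inverse_0_at_top filterlim_ident)
  then have "((\<lambda>R::real. 1 + D * inverse R) \<longlongrightarrow> 1) at_top" by simp
  moreover have "\<forall>\<^sub>F R::real in at_top. 1 + D * inverse R = (R + D) / R"
    using eventually_gt_at_top[of 0] by eventually_elim (simp add: field_simps)
  ultimately have "((\<lambda>R::real. (R + D) / R) \<longlongrightarrow> 1) at_top"
    by (rule Lim_transform_eventually)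
  from tendsto_power[OF this, of n] show ?thesis by simp
qed

text \<open>The cells attached to the points of the affine lattice tile the space. Those attached to
  points of the ball of radius \<open>R\<close> cover the ball of radius \<open>R - D\<close> and
  stay inside that of radius \<open>R + D\<close>. Comparing volumes squeezes the count; the density
  is the reciprocal of the cell volume \<open>c\<close>.\<close>

lemma affine_lattice_density:
  fixes A :: "real^'n^'n"
  assumes A: "invertible A"
  shows "\<exists>d. has_density (range (\<lambda>z. r + A *v vec_of_int z)) d"
proof -
  let ?n = "CARD('n)" and ?v = "unit_ball_vol (real CARD('n))"
  let ?Y = "range (\<lambda>z. r + A *v vec_of_int z)"
  let ?C = "half_open_cube :: (real^'n) set"
  define c where "c = measure lebesgue ((*v) A ` ?C)"
  obtain A' where A': "A ** A' = mat 1" "A' ** A = mat 1"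
    using A unfolding invertible_def by blast
  have injA: "inj ((*v) A)" by (rule inj_matrix_vector_mult[OF A])
  have bdd: "bounded ((*v) A ` ?C)"
    by (intro bounded_linear_image matrix_vector_mul_bounded_linear bounded_subset[OF bounded_cbox[of 0 1]])
       (auto simp: half_open_cube_def mem_box_cart less_imp_le)
  from bdd obtain D where D: "D > 0" "\<And>u. u \<in> ?C \<Longrightarrow> norm (A *v u) \<le> D"
    unfolding bounded_pos by auto
  define cell where "cell z = (\<lambda>x. (r + A *v vec_of_int z) + x) ` ((*v) A ` ?C)" for z
  \<comment> \<open>As \<open>A\<close> is invertible, the image of the cube is also its preimage
    under the inverse map, hence a Borel set.\<close>
  have cell_meas: "cell z \<in> lmeasurable" "measure lebesgue (cell z) = c" for z
  proof -
    have "(*v) A ` ?C = (*v) A' -` ?C"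
    proof (intro equalityI subsetI)
      fix x assume "x \<in> (*v) A ` ?C"
      then show "x \<in> (*v) A' -` ?C" by (auto simp: matrix_vector_mul_assoc A')
    next
      fix x assume "x \<in> (*v) A' -` ?C"
      moreover have "x = A *v (A' *v x)" by (simp add: matrix_vector_mul_assoc A')
      ultimately show "x \<in> (*v) A ` ?C" by blast
    qed
    moreover have "(*v) A' \<in> borel_measurable borel"
      by (intro borel_measurable_continuous_onI linear_continuous_on matrix_vector_mul_bounded_linear)
    ultimately have "(*v) A ` ?C \<in> sets borel"
      using measurable_sets_borel borel_half_open_cube by metis
    then have m: "(*v) A ` ?C \<in> lmeasurable"
      using bdd by (intro bounded_set_imp_lmeasurable) auto
    show "cell z \<in> lmeasurable"
      unfolding cell_def by (rule measurable_translation[OF m])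
    show "measure lebesgue (cell z) = c"
      unfolding cell_def c_def by (rule measure_translation)
  qed
  \<comment> \<open>Half-openness makes the index of a cell unique: it is the componentwise floor of
    the coordinate vector of any point in the cell. This yields disjointness; \<open>cover\<close>
    is the converse.\<close>
  have cell_floor: "z = (\<chi> i. \<lfloor>w $ i\<rfloor>)" if w: "r + A *v w \<in> cell z" for z w
  proof -
    obtain u where u: "u \<in> ?C" "r + A *v w = r + A *v vec_of_int z + A *v u"
      using w unfolding cell_def by (auto simp: add.assoc)
    then have "A *v w = A *v (vec_of_int z + u)" by (simp add: matrix_vector_right_distrib)
    then have "w = vec_of_int z + u" by (simp only: inj_eq[OF injA])
    moreover have "0 \<le> u $ i" "u $ i < 1" for i using u(1) by (auto simp: half_open_cube_def)
    ultimately show ?thesis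
      by (simp add: vec_eq_iff vec_of_int_def floor_add_int[symmetric] floor_eq_iff)
  qed
  have surj: "\<exists>w. x = r + A *v w" for x
    by (rule exI[of _ "A' *v (x - r)"]) (simp add: matrix_vector_mul_assoc A')
  have disj: "pairwise (\<lambda>z z'. disjnt (cell z) (cell z')) X" for X
    unfolding pairwise_def disjnt_def
  proof safe
    fix z z' x assume "z \<noteq> z'" "x \<in> cell z" "x \<in> cell z'"
    moreover obtain w where "x = r + A *v w" using surj by blast
    ultimately show "x \<in> {}" using cell_floor[of w] by blast
  qed
  have cover: "x \<in> cell (\<chi> i. \<lfloor>w $ i\<rfloor>)" if "x = r + A *v w" for x w
  proof -
    have "w - vec_of_int (\<chi> i. \<lfloor>w $ i\<rfloor>) \<in> ?C"
      by (auto simp: half_open_cube_def vec_of_int_def) linarith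
    moreover have "x = r + A *v vec_of_int (\<chi> i. \<lfloor>w $ i\<rfloor>) + A *v (w - vec_of_int (\<chi> i. \<lfloor>w $ i\<rfloor>))"
      using that by (simp add: matrix_vector_mult_diff_distrib)
    ultimately show ?thesis unfolding cell_def by blast
  qed
  have near: "norm (x - (r + A *v vec_of_int z)) \<le> D" if "x \<in> cell z" for x z
    using that D(2) unfolding cell_def by auto
  define Z where "Z R = {z. r + A *v vec_of_int z \<in> ball 0 R}" for R
  have finZ: "finite (Z R)" for R
    unfolding Z_def using finite_affine_lattice_ball[OF A] .
  have card: "card (?Y \<inter> ball 0 R) = card (Z R)" for R
  proof -
    have "?Y \<inter> ball 0 R = (\<lambda>z. r + A *v vec_of_int z) ` Z R" unfolding Z_def by auto
    moreover have "inj_on (\<lambda>z. r + A *v vec_of_int z) (Z R)"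
      by (rule inj_onI) (simp add: inj_eq[OF injA])
    ultimately show ?thesis by (simp add: card_image)
  qed
  have U: "(\<Union>z\<in>Z R. cell z) \<in> lmeasurable"
      "measure lebesgue (\<Union>z\<in>Z R. cell z) = real (card (Z R)) * c" for R
  proof -
    show "(\<Union>z\<in>Z R. cell z) \<in> lmeasurable" using finZ cell_meas by (intro fmeasurable.finite_UN) auto
    have "measure lebesgue (\<Union>z\<in>Z R. cell z) = (\<Sum>z\<in>Z R. measure lebesgue (cell z))"
      using finZ cell_meas disj by (intro measure_UNION') auto
    then show "measure lebesgue (\<Union>z\<in>Z R. cell z) = real (card (Z R)) * c"
      by (simp add: cell_meas)
  qed
  have ball: "measure lebesgue (ball (0::real^'n) R) = ?v * R ^ ?n" if "R \<ge> 0" for R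
    using that by (simp add: measure_completion content_ball)
  have upper: "real (card (Z R)) * c \<le> ?v * (R + D) ^ ?n" if "R > 0" for R
  proof -
    have "(\<Union>z\<in>Z R. cell z) \<subseteq> ball 0 (R + D)"
    proof safe
      fix z x assume "z \<in> Z R" "x \<in> cell z"
      then show "x \<in> ball 0 (R + D)"
        using near[of x z] norm_triangle_sub[of x "r + A *v vec_of_int z"] by (simp add: Z_def)
    qed
    then have "measure lebesgue (\<Union>z\<in>Z R. cell z) \<le> measure lebesgue (ball (0::real^'n) (R + D))"
      using U by (intro measure_mono_fmeasurable) auto
    then show ?thesis using U ball[of "R + D"] that D by simp
  qed
  have lower: "?v * (R - D) ^ ?n \<le> real (card (Z R)) * c" if "R > D" for R
  proof -
    have "ball 0 (R - D) \<subseteq> (\<Union>z\<in>Z R. cell z)"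
    proof
      fix x :: "real^'n" assume x: "x \<in> ball 0 (R - D)"
      obtain w where "x = r + A *v w" using surj by blast
      from cover[OF this] obtain z where z: "x \<in> cell z" by blast
      have "z \<in> Z R"
        using near[OF z] x norm_triangle_sub[of "r + A *v vec_of_int z" x]
        by (simp add: Z_def norm_minus_commute)
      then show "x \<in> (\<Union>z\<in>Z R. cell z)" using z by blast
    qed
    then have "measure lebesgue (ball (0::real^'n) (R - D)) \<le> measure lebesgue (\<Union>z\<in>Z R. cell z)"
      using U by (intro measure_mono_fmeasurable) auto
    then show ?thesis using U ball[of "R - D"] that D by simp
  qed
  have v_pos: "?v > 0" by simp
  then have v: "?v \<noteq> 0" by linarith
  \<comment> \<open>At radius \<open>D + 1\<close> the ball to be covered has radius
    \<open>1\<close> and positive volume, which forces \<open>c\<close> to be positive.\<close>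
  have "0 < real (card (Z (D + 1))) * c"
    using less_le_trans[OF v_pos, of "real (card (Z (D + 1))) * c"] lower[of "D + 1"] by simp
  then have c: "c > 0" by (simp add: zero_less_mult_iff)
  have "((\<lambda>R. ((R + (- D)) / R) ^ ?n * (1 / c)) \<longlongrightarrow> 1 * (1 / c)) at_top"
    by (intro tendsto_mult tendsto_shift_ratio_power tendsto_const)
  moreover have "((\<lambda>R. ((R + D) / R) ^ ?n * (1 / c)) \<longlongrightarrow> 1 * (1 / c)) at_top"
    by (intro tendsto_mult tendsto_shift_ratio_power tendsto_const)
  moreover have "\<forall>\<^sub>F R in at_top. ((R + (- D)) / R) ^ ?n * (1 / c) \<le> normalized_count ?Y R"
    using eventually_gt_at_top[of D]
  proof eventually_elim
    case (elim R)
    have "?v * (R - D) ^ ?n / (R ^ ?n * ?v * c) \<le> real (card (Z R)) * c / (R ^ ?n * ?v * c)"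
      using lower[OF elim] D c elim by (intro divide_right_mono) auto
    then show ?case using c v by (simp add: normalized_count_def card power_divide)
  qed
  moreover have "\<forall>\<^sub>F R in at_top. normalized_count ?Y R \<le> ((R + D) / R) ^ ?n * (1 / c)"
    using eventually_gt_at_top[of 0]
  proof eventually_elim
    case (elim R)
    have "real (card (Z R)) * c / (R ^ ?n * ?v * c) \<le> ?v * (R + D) ^ ?n / (R ^ ?n * ?v * c)"
      using upper[OF elim] D c elim by (intro divide_right_mono) auto
    then show ?case using c v by (simp add: normalized_count_def card power_divide)
  qed
  ultimately show ?thesis
    unfolding has_density_iff by (intro exI[of _ "1 * (1 / c)"]) (rule tendsto_sandwich)
qed

section \<open>The group structure of a lattice, its separation and its residue classes\<close>

lemma lattice_basisE:
  fixes \<Lambda> :: "(real^'n) set"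
  assumes "is_lattice \<Lambda>"
  obtains B :: "real^'n^'n" where "invertible B" "\<Lambda> = range (\<lambda>z. B *v vec_of_int z)"
  using assms unfolding is_lattice_def lattice_basis_def vec_of_int_def by blast

lemma lattice_zero:
  fixes \<Lambda> :: "(real^'n) set"
  assumes "is_lattice \<Lambda>"
  shows "0 \<in> \<Lambda>"
proof -
  obtain B :: "real^'n^'n" where "invertible B" and B: "\<Lambda> = range (\<lambda>z. B *v vec_of_int z)"
    by (rule lattice_basisE[OF assms])
  have "0 = B *v vec_of_int 0" by simp
  then show ?thesis unfolding B by (rule range_eqI)
qed

lemma lattice_add:
  fixes \<Lambda> :: "(real^'n) set"
  assumes "is_lattice \<Lambda>" "x \<in> \<Lambda>" "y \<in> \<Lambda>"
  shows "x + y \<in> \<Lambda>"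
proof -
  obtain B :: "real^'n^'n" where "invertible B" and B: "\<Lambda> = range (\<lambda>z. B *v vec_of_int z)"
    by (rule lattice_basisE[OF assms(1)])
  obtain a b where "x = B *v vec_of_int a" "y = B *v vec_of_int b" using assms B by blast
  then have "x + y = B *v vec_of_int (a + b)" by (simp add: matrix_vector_right_distrib)
  then show ?thesis unfolding B by (rule range_eqI)
qed

lemma lattice_diff:
  fixes \<Lambda> :: "(real^'n) set"
  assumes "is_lattice \<Lambda>" "x \<in> \<Lambda>" "y \<in> \<Lambda>"
  shows "x - y \<in> \<Lambda>"
proof -
  obtain B :: "real^'n^'n" where "invertible B" and B: "\<Lambda> = range (\<lambda>z. B *v vec_of_int z)"
    by (rule lattice_basisE[OF assms(1)])
  obtain a b where "x = B *v vec_of_int a" "y = B *v vec_of_int b" using assms B by blast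
  then have "x - y = B *v vec_of_int (a - b)" by (simp add: matrix_vector_mult_diff_distrib)
  then show ?thesis unfolding B by (rule range_eqI)
qed

lemma lattice_scale:
  fixes \<Lambda> :: "(real^'n) set"
  assumes "is_lattice \<Lambda>" "x \<in> \<Lambda>"
  shows "real m *\<^sub>R x \<in> \<Lambda>"
proof -
  obtain B :: "real^'n^'n" where "invertible B" and B: "\<Lambda> = range (\<lambda>z. B *v vec_of_int z)"
    by (rule lattice_basisE[OF assms(1)])
  obtain a where "x = B *v vec_of_int a" using assms B by blast
  then have "real m *\<^sub>R x = B *v vec_of_int (\<chi> i. int m * a $ i)"
    by (simp add: linear_scale[OF matrix_vector_mul_linear])
  then show ?thesis unfolding B by (rule range_eqI)
qed

lemma finite_lattice_ball:
  fixes \<Lambda> :: "(real^'n) set"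
  assumes "is_lattice \<Lambda>"
  shows "finite (\<Lambda> \<inter> ball 0 R)"
proof -
  obtain B :: "real^'n^'n" where B: "invertible B" "\<Lambda> = range (\<lambda>z. B *v vec_of_int z)"
    by (rule lattice_basisE[OF assms])
  have "\<Lambda> \<inter> ball 0 R \<subseteq> (\<lambda>z. B *v vec_of_int z) ` {z. 0 + B *v vec_of_int z \<in> ball 0 R}"
    unfolding B by auto
  then show ?thesis using finite_affine_lattice_ball[OF B(1)] finite_surj by blast
qed

text \<open>The unit ball contains only finitely many lattice points. Adding \<open>1\<close> to the
  set of their norms keeps the minimum defined and handles the points outside the ball.\<close>

lemma lattice_separated:
  fixes \<Lambda> :: "(real^'n) set"
  assumes "is_lattice \<Lambda>"
  obtains s where "s > 0" "\<And>x. x \<in> \<Lambda> \<Longrightarrow> x \<noteq> 0 \<Longrightarrow> s \<le> norm x"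
proof -
  let ?N = "norm ` ((\<Lambda> \<inter> ball 0 1) - {0}) \<union> {1}"
  have fin: "finite ?N" using finite_lattice_ball[OF assms] by simp
  show thesis
  proof
    show "Min ?N > 0" using fin by (subst Min_gr_iff) auto
    fix x assume "x \<in> \<Lambda>" "x \<noteq> 0"
    show "Min ?N \<le> norm x"
    proof (cases "norm x < 1")
      case True
      then show ?thesis using fin \<open>x \<in> \<Lambda>\<close> \<open>x \<noteq> 0\<close> by (intro Min_le) auto
    next
      case False
      have "Min ?N \<le> 1" using fin by (intro Min_le) auto
      then show ?thesis using False by simp
    qed
  qed
qed

text \<open>Representatives of \<open>\<Lambda>\<close> modulo \<open>m \<Lambda>\<close> are the
  points with all basis coordinates in \<open>{0..m - 1}\<close>; \<open>div\<close> and
  \<open>mod\<close> on the coordinates give existence and uniqueness.\<close>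

lemma lattice_residues:
  fixes \<Lambda> :: "(real^'n) set"
  assumes "is_lattice \<Lambda>" "m \<ge> 1"
  obtains F where "finite F" "F \<subseteq> \<Lambda>"
    "\<And>t. t \<in> \<Lambda> \<Longrightarrow> \<exists>r\<in>F. \<exists>l\<in>\<Lambda>. t = r + real m *\<^sub>R l"
    "\<And>r r' l l'. r \<in> F \<Longrightarrow> r' \<in> F \<Longrightarrow> l \<in> \<Lambda> \<Longrightarrow> l' \<in> \<Lambda> \<Longrightarrow>
       r + real m *\<^sub>R l = r' + real m *\<^sub>R l' \<Longrightarrow> r = r'"
proof -
  obtain B :: "real^'n^'n" where B: "invertible B" "\<Lambda> = range (\<lambda>z. B *v vec_of_int z)"
    by (rule lattice_basisE[OF assms(1)])
  have injB: "inj ((*v) B)" by (rule inj_matrix_vector_mult[OF B(1)])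
  define W where "W = {w :: int^'n. \<forall>i. 0 \<le> w $ i \<and> w $ i \<le> int m - 1}"
  have comb: "B *v vec_of_int w + real m *\<^sub>R (B *v vec_of_int z)
      = B *v vec_of_int (w + (\<chi> i. int m * z $ i))" for w z
    by (simp add: linear_scale[OF matrix_vector_mul_linear] matrix_vector_right_distrib)
  show thesis
  proof (rule that[of "(\<lambda>w. B *v vec_of_int w) ` W"])
    show "finite ((\<lambda>w. B *v vec_of_int w) ` W)"
      unfolding W_def by (intro finite_imageI finite_bounded_int_vec)
    show "(\<lambda>w. B *v vec_of_int w) ` W \<subseteq> \<Lambda>" unfolding B by blast
  next
    fix t assume "t \<in> \<Lambda>"
    then obtain a where a: "t = B *v vec_of_int a" unfolding B by blast
    define w :: "int^'n" where "w = (\<chi> i. a $ i mod int m)"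
    define z :: "int^'n" where "z = (\<chi> i. a $ i div int m)"
    have "a = w + (\<chi> i. int m * z $ i)" by (simp add: w_def z_def vec_eq_iff)
    then have "t = B *v vec_of_int w + real m *\<^sub>R (B *v vec_of_int z)" using a comb by metis
    moreover have "w \<in> W" using assms(2) by (simp add: W_def w_def)
    moreover have "B *v vec_of_int z \<in> \<Lambda>" unfolding B by blast
    ultimately show "\<exists>r\<in>(\<lambda>w. B *v vec_of_int w) ` W. \<exists>l\<in>\<Lambda>. t = r + real m *\<^sub>R l" by blast
  next
    fix r r' l l'
    assume "r \<in> (\<lambda>w. B *v vec_of_int w) ` W" "r' \<in> (\<lambda>w. B *v vec_of_int w) ` W"
      and "l \<in> \<Lambda>" "l' \<in> \<Lambda>" and eq: "r + real m *\<^sub>R l = r' + real m *\<^sub>R l'"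
    then obtain w w' z z' where wz: "r = B *v vec_of_int w" "r' = B *v vec_of_int w'"
      "l = B *v vec_of_int z" "l' = B *v vec_of_int z'" "w \<in> W" "w' \<in> W" unfolding B by blast
    have "w + (\<chi> i. int m * z $ i) = w' + (\<chi> i. int m * z' $ i)"
      using eq unfolding wz comb by (simp only: inj_eq[OF injB] vec_of_int_inject)
    then have e: "w $ i + int m * z $ i = w' $ i + int m * z' $ i" for i
      by (simp add: vec_eq_iff)
    have "w $ i = w' $ i" for i
    proof -
      have "(w $ i + int m * z $ i) mod int m = (w' $ i + int m * z' $ i) mod int m"
        using e by metis
      moreover have "0 \<le> w $ i" "w $ i < int m" "0 \<le> w' $ i" "w' $ i < int m"
        using wz(5,6) by (auto simp: W_def dest: spec[of _ i])
      ultimately show ?thesis by simp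
    qed
    then have "w = w'" by (simp add: vec_eq_iff)
    then show "r = r'" using wz by simp
  qed
qed

section \<open>Additivity of densities and densities of periodic sets\<close>

lemma has_density_empty: "has_density {} 0"
  unfolding has_density_def by simp

text \<open>Local finiteness is assumed because \<open>card\<close> sends infinite sets to
  \<open>0\<close>, so that it adds up over disjoint sets only when they are finite.\<close>

lemma has_density_Un:
  fixes Y Z :: "(real^'n) set"
  assumes "has_density Y d" "has_density Z e" "Y \<inter> Z = {}"
    and fin: "\<And>R. finite ((Y \<union> Z) \<inter> ball 0 R)"
  shows "has_density (Y \<union> Z) (d + e)"
proof -
  have "normalized_count (Y \<union> Z) = (\<lambda>R. normalized_count Y R + normalized_count Z R)"
  proof
    fix R
    have "card ((Y \<union> Z) \<inter> ball 0 R) = card (Y \<inter> ball 0 R) + card (Z \<inter> ball 0 R)"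
      using fin[of R] assms(3) unfolding Int_Un_distrib2
      by (subst card_Un_disjoint) auto
    then show "normalized_count (Y \<union> Z) R = normalized_count Y R + normalized_count Z R"
      by (simp add: normalized_count_def add_divide_distrib)
  qed
  then show ?thesis using assms(1,2) unfolding has_density_iff by (simp add: tendsto_add)
qed

lemma has_density_UN:
  assumes "finite I" "\<And>i. i \<in> I \<Longrightarrow> has_density (Y i) (d i)"
    and "\<And>i j. i \<in> I \<Longrightarrow> j \<in> I \<Longrightarrow> i \<noteq> j \<Longrightarrow> Y i \<inter> Y j = {}"
    and "\<And>R. finite ((\<Union>i\<in>I. Y i) \<inter> ball 0 R)"
  shows "has_density (\<Union>i\<in>I. Y i) (\<Sum>i\<in>I. d i)"
  using assms
proof (induction I)
  case empty
  then show ?case by (simp add: has_density_empty)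
next
  case (insert i I)
  have "finite ((\<Union>i\<in>I. Y i) \<inter> ball 0 R)" for R
    using insert.prems(3)[of R] by (rule rev_finite_subset) auto
  then have "has_density (\<Union>i\<in>I. Y i) (\<Sum>i\<in>I. d i)"
    using insert.prems by (intro insert.IH) auto
  moreover have "Y i \<inter> (\<Union>i\<in>I. Y i) = {}"
    using insert.prems(2)[of i] insert.hyps by fastforce
  ultimately have "has_density (Y i \<union> (\<Union>i\<in>I. Y i)) (d i + (\<Sum>i\<in>I. d i))"
    using insert.prems(1)[of i] insert.prems(3) by (intro has_density_Un) auto
  then show ?case using insert.hyps by simp
qed

text \<open>The coset is again an affine lattice, spanned by the basis scaled by
  \<open>m\<close>.\<close>

lemma lattice_coset_density:
  fixes \<Lambda> :: "(real^'n) set"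
  assumes "is_lattice \<Lambda>" "m \<ge> 1"
  shows "\<exists>d. has_density ((\<lambda>l. r + real m *\<^sub>R l) ` \<Lambda>) d"
proof -
  obtain B :: "real^'n^'n" where B: "invertible B" "\<Lambda> = range (\<lambda>z. B *v vec_of_int z)"
    by (rule lattice_basisE[OF assms(1)])
  have "invertible (real m *\<^sub>R B)" using B(1) assms(2) by (intro scalar_invertible) auto
  then obtain d where "has_density (range (\<lambda>z. r + (real m *\<^sub>R B) *v vec_of_int z)) d"
    using affine_lattice_density by blast
  moreover have "range (\<lambda>z. r + (real m *\<^sub>R B) *v vec_of_int z) = (\<lambda>l. r + real m *\<^sub>R l) ` \<Lambda>"
    unfolding B by (simp add: image_image scaleR_matrix_vector_assoc)
  ultimately show ?thesis by auto
qed

lemma lattice_density: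
  fixes \<Lambda> :: "(real^'n) set"
  assumes "is_lattice \<Lambda>"
  shows "\<exists>d. has_density \<Lambda> d"
  using lattice_coset_density[OF assms, of 1 0] by simp

text \<open>Such a set is the disjoint union of the cosets of \<open>m \<Lambda>\<close> through
  those of the finitely many representatives that belong to it.\<close>

lemma periodic_density:
  fixes \<Lambda> :: "(real^'n) set"
  assumes lat: "is_lattice \<Lambda>" and m: "m \<ge> 1" and "Y \<subseteq> \<Lambda>"
    and per: "\<And>t l. t \<in> \<Lambda> \<Longrightarrow> l \<in> \<Lambda> \<Longrightarrow> t + real m *\<^sub>R l \<in> Y \<longleftrightarrow> t \<in> Y"
  shows "\<exists>d. has_density Y d"
proof -
  obtain F where F: "finite F" "F \<subseteq> \<Lambda>"
    "\<And>t. t \<in> \<Lambda> \<Longrightarrow> \<exists>r\<in>F. \<exists>l\<in>\<Lambda>. t = r + real m *\<^sub>R l"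
    "\<And>r r' l l'. r \<in> F \<Longrightarrow> r' \<in> F \<Longrightarrow> l \<in> \<Lambda> \<Longrightarrow> l' \<in> \<Lambda> \<Longrightarrow>
       r + real m *\<^sub>R l = r' + real m *\<^sub>R l' \<Longrightarrow> r = r'"
    using lattice_residues[OF lat m] by blast
  define C where "C r = (\<lambda>l. r + real m *\<^sub>R l) ` \<Lambda>" for r
  obtain d where d: "\<And>r. has_density (C r) (d r)"
    using lattice_coset_density[OF lat m] unfolding C_def by metis
  have Y: "Y = (\<Union>r\<in>F \<inter> Y. C r)"
  proof (intro equalityI subsetI)
    fix t assume t: "t \<in> Y"
    then obtain r l where "r \<in> F" "l \<in> \<Lambda>" "t = r + real m *\<^sub>R l" using F(3) \<open>Y \<subseteq> \<Lambda>\<close> by blast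
    then show "t \<in> (\<Union>r\<in>F \<inter> Y. C r)" using per[of r l] t F(2) by (auto simp: C_def)
  next
    fix t assume "t \<in> (\<Union>r\<in>F \<inter> Y. C r)"
    then show "t \<in> Y" using per F(2) by (auto simp: C_def)
  qed
  have "has_density (\<Union>r\<in>F \<inter> Y. C r) (\<Sum>r\<in>F \<inter> Y. d r)"
  proof (rule has_density_UN)
    show "finite (F \<inter> Y)" using F(1) by simp
    show "C r \<inter> C r' = {}" if "r \<in> F \<inter> Y" "r' \<in> F \<inter> Y" "r \<noteq> r'" for r r'
      using that F(4)[of r r'] by (auto simp: C_def)
    show "finite ((\<Union>r\<in>F \<inter> Y. C r) \<inter> ball 0 R)" for R
      using finite_lattice_ball[OF lat, of R] \<open>Y \<subseteq> \<Lambda>\<close> unfolding Y[symmetric]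
      by (rule_tac rev_finite_subset) auto
  qed (use d in auto)
  then show ?thesis using Y by auto
qed

text \<open>Without the origin one constant serves all radii, however small: up to the separation
  constant \<open>s\<close> there is nothing to count, from \<open>R0\<close> on the density
  controls the count, and in between the count is bounded while \<open>r ^ n\<close> stays above
  \<open>s ^ n\<close>. Small radii arise when the radius of a ball is divided by a large
  \<open>c ^ k\<close>.\<close>

lemma lattice_ball_card_bound:
  fixes \<Lambda> :: "(real^'n) set"
  assumes lat: "is_lattice \<Lambda>"
  obtains C where "C > 0"
    "\<And>r. r > 0 \<Longrightarrow> real (card (\<Lambda> \<inter> ball 0 r - {0})) \<le> C * r ^ CARD('n)"
proof -
  let ?n = "CARD('n)" and ?v = "unit_ball_vol (real CARD('n))"
  have v: "?v > 0" by simp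
  obtain d where "has_density \<Lambda> d" using lattice_density[OF lat] by blast
  then have lim: "(normalized_count \<Lambda> \<longlongrightarrow> d) at_top" by (simp add: has_density_iff)
  have "\<forall>\<^sub>F R in at_top. normalized_count \<Lambda> R < d + 1"
    using order_tendstoD(2)[OF lim] by simp
  then obtain R0 where R0: "\<And>R. R \<ge> R0 \<Longrightarrow> normalized_count \<Lambda> R < d + 1"
    unfolding eventually_at_top_linorder by blast
  obtain s where s: "s > 0" "\<And>x. x \<in> \<Lambda> \<Longrightarrow> x \<noteq> 0 \<Longrightarrow> s \<le> norm x"
    using lattice_separated[OF lat] by blast
  define K where "K = real (card (\<Lambda> \<inter> ball 0 R0))"
  \<comment> \<open>The first two summands serve the large and the intermediate radii; the last one
    makes the constant positive.\<close>
  define C where "C = \<bar>d + 1\<bar> * ?v + K / s ^ ?n + 1"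
  have C: "C > 0" "\<bar>d + 1\<bar> * ?v \<le> C" "K / s ^ ?n \<le> C"
    using v s by (simp_all add: C_def K_def add_nonneg_pos)
  have mono: "card (\<Lambda> \<inter> ball 0 r - {0}) \<le> card (\<Lambda> \<inter> ball 0 R)" if "r \<le> R" for r R
    using that finite_lattice_ball[OF lat] by (intro card_mono) auto
  show thesis
  proof (rule that[OF C(1)])
    fix r :: real assume r: "r > 0"
    consider "r \<ge> R0" | "r \<le> s" | "r < R0" "r > s" by linarith
    then show "real (card (\<Lambda> \<inter> ball 0 r - {0})) \<le> C * r ^ ?n"
    proof cases
      case 1
      then have "real (card (\<Lambda> \<inter> ball 0 r)) / (r ^ ?n * ?v) \<le> \<bar>d + 1\<bar>"
        using R0[of r] by (simp add: normalized_count_def)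
      then have "real (card (\<Lambda> \<inter> ball 0 r)) \<le> (\<bar>d + 1\<bar> * ?v) * r ^ ?n"
        using r v by (subst (asm) pos_divide_le_eq) (auto simp: mult.assoc mult.commute[of ?v])
      also have "\<dots> \<le> C * r ^ ?n" using C r by (intro mult_right_mono) auto
      finally show ?thesis using mono[of r r] by simp
    next
      case 2
      then have "\<Lambda> \<inter> ball 0 r - {0} = {}" using s(2) by fastforce
      then have "card (\<Lambda> \<inter> ball 0 r - {0}) = 0" by (simp only: card.empty)
      then show ?thesis using C r by simp
    next
      case 3
      have "K / s ^ ?n * s ^ ?n \<le> C * r ^ ?n"
        using 3 C s by (intro mult_mono power_mono) (auto simp: K_def)
      then have "K \<le> C * r ^ ?n" using s by simp
      then show ?thesis using mono[of r R0] 3 by (simp add: K_def)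
    qed
  qed
qed

subsection \<open>Sieving\<close>

definition multiples :: "nat \<Rightarrow> (real^'n) set \<Rightarrow> nat \<Rightarrow> (real^'n) set" where
  "multiples k \<Lambda> c = (*\<^sub>R) (real (c ^ k)) ` \<Lambda>"

definition sieved :: "nat \<Rightarrow> (real^'n) set \<Rightarrow> nat \<Rightarrow> (real^'n) set" where
  "sieved k \<Lambda> N = \<Lambda> - (\<Union>c\<in>{2..N}. multiples k \<Lambda> c)"

text \<open>A superset of what separates the sieved set from the k-free points: points removed by
  the sieve may occur here again, and for a lattice \<open>0\<close> always does.\<close>

definition sieve_tail :: "nat \<Rightarrow> (real^'n) set \<Rightarrow> nat \<Rightarrow> (real^'n) set" where
  "sieve_tail k \<Lambda> N = (\<Union>c\<in>{N<..}. multiples k \<Lambda> c)"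

section \<open>The k-free points as the result of a sieve\<close>

lemma le_self_power: 
  fixes c :: nat
  assumes "k \<ge> 1" shows "c \<le> c ^ k"
  using assms by (cases "c = 0") (auto intro: self_le_power)

text \<open>The \<open>GREATEST\<close> in \<open>k_content\<close> is attained: if \<open>l\<close>
  is \<open>c ^ k\<close> times a lattice point and \<open>c \<ge> 1\<close>, then
  \<open>norm l \<ge> c * s\<close> with the separation constant \<open>s\<close>, so only finitely
  many positive \<open>c\<close> are admissible.\<close>

lemma k_content_eq_1_iff:
  fixes \<Lambda> :: "(real^'n) set"
  assumes lat: "is_lattice \<Lambda>" and k: "k \<ge> 1" and l: "l \<in> \<Lambda>" "l \<noteq> 0"
  shows "k_content k \<Lambda> l = 1 \<longleftrightarrow> (\<forall>c\<ge>2. l \<notin> multiples k \<Lambda> c)"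
proof -
  define A where "A = {c :: int. l \<in> (*\<^sub>R) (of_int (c ^ k)) ` \<Lambda>}"
  obtain s where s: "s > 0" "\<And>x. x \<in> \<Lambda> \<Longrightarrow> x \<noteq> 0 \<Longrightarrow> s \<le> norm x"
    using lattice_separated[OF lat] by blast
  have one: "1 \<in> A" unfolding A_def using l by force
  have bound: "c \<le> \<lceil>norm l / s\<rceil>" if c: "c \<in> A" "c \<ge> 1" for c
  proof -
    obtain x where x: "x \<in> \<Lambda>" "l = of_int (c ^ k) *\<^sub>R x" using c(1) unfolding A_def by blast
    then have "x \<noteq> 0" using l by auto
    then have "s \<le> norm x" using s x by blast
    have "c \<le> c ^ k" using c(2) k by (intro self_le_power) auto
    then have "real_of_int c \<le> real_of_int (c ^ k)" by (simp only: of_int_le_iff)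
    then have "real_of_int c * s \<le> real_of_int (c ^ k) * norm x"
      using \<open>s \<le> norm x\<close> s c(2) by (intro mult_mono) auto
    also have "\<dots> = norm l" using x c(2) by simp
    finally have "real_of_int c \<le> norm l / s" using s by (simp add: pos_le_divide_eq)
    then show ?thesis by linarith
  qed
  \<comment> \<open>Since \<open>1\<close> is admissible, the maximum over the positive admissible
    integers is the maximum over all of them.\<close>
  define g where "g = Max (A \<inter> {1..\<lceil>norm l / s\<rceil>})"
  have fin: "finite (A \<inter> {1..\<lceil>norm l / s\<rceil>})" by simp
  have "1 \<in> A \<inter> {1..\<lceil>norm l / s\<rceil>}" using one bound[OF one] by simp
  then have gA: "g \<in> A \<inter> {1..\<lceil>norm l / s\<rceil>}"
    unfolding g_def using fin by (intro Max_in) auto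
  have g_max: "c \<le> g" if "c \<in> A" for c
  proof (cases "c \<ge> 1")
    case True
    then show ?thesis unfolding g_def using fin bound[OF that True] that by (intro Max_ge) auto
  next
    case False
    then show ?thesis using gA by auto
  qed
  have "(GREATEST c. c \<in> A) = g" using gA g_max by (intro Greatest_equality) auto
  then have "k_content k \<Lambda> l = enat (nat g)"
    using l(2) by (simp add: k_content_def A_def)
  then have "k_content k \<Lambda> l = 1 \<longleftrightarrow> g = 1"
    using gA by (auto simp: one_enat_def)
  also have "\<dots> \<longleftrightarrow> (\<forall>c\<ge>2. l \<notin> multiples k \<Lambda> c)"
  proof
    assume "g = 1"
    show "\<forall>c\<ge>2. l \<notin> multiples k \<Lambda> c"
    proof (intro allI impI notI)
      fix c :: nat assume "c \<ge> 2" "l \<in> multiples k \<Lambda> c"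
      then have "int c \<in> A" by (simp add: A_def multiples_def)
      then show False using g_max \<open>g = 1\<close> \<open>c \<ge> 2\<close> by fastforce
    qed
  next
    assume r: "\<forall>c\<ge>2. l \<notin> multiples k \<Lambda> c"
    have "l \<in> multiples k \<Lambda> (nat g)" using gA by (simp add: A_def multiples_def)
    then have "\<not> nat g \<ge> 2" using r by blast
    then show "g = 1" using gA by auto
  qed
  finally show ?thesis .
qed

text \<open>The condition over all \<open>c \<ge> 2\<close> is split at \<open>N\<close>;
  \<open>N \<ge> 1\<close> keeps \<open>c = 1\<close>, whose multiples are the whole lattice, out of
  the tail. The origin has infinite content and is a multiple for every \<open>c\<close>, so both
  sides exclude it.\<close>

lemma k_free_points_eq:
  fixes \<Lambda> :: "(real^'n) set"
  assumes lat: "is_lattice \<Lambda>" and k: "k \<ge> 1" and N: "N \<ge> 1"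
  shows "k_free_points k \<Lambda> = sieved k \<Lambda> N - sieve_tail k \<Lambda> N"
proof -
  have "l \<in> k_free_points k \<Lambda> \<longleftrightarrow> l \<in> sieved k \<Lambda> N - sieve_tail k \<Lambda> N" for l
  proof (cases "l \<in> \<Lambda>")
    case l: True
    have "l \<in> k_free_points k \<Lambda> \<longleftrightarrow> (\<forall>c\<ge>2. l \<notin> multiples k \<Lambda> c)"
    proof (cases "l = 0")
      case True
      then have "l \<in> multiples k \<Lambda> 2" unfolding multiples_def using l by force
      moreover have "l \<notin> k_free_points k \<Lambda>"
        using True by (simp add: k_free_points_def k_content_def)
      ultimately show ?thesis by auto
    next
      case False
      then show ?thesis using k_content_eq_1_iff[OF lat k l] l by (simp add: k_free_points_def)
    qed
    also have "\<dots> \<longleftrightarrow> (\<forall>c\<in>{2..N} \<union> {N<..}. l \<notin> multiples k \<Lambda> c)"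
    proof -
      have "{2..N} \<union> {N<..} = {c. c \<ge> 2}" using N by auto
      then show ?thesis by simp
    qed
    also have "\<dots> \<longleftrightarrow> l \<in> sieved k \<Lambda> N - sieve_tail k \<Lambda> N"
      using l by (simp add: sieved_def sieve_tail_def ball_Un)
    finally show ?thesis .
  next
    case False
    then show ?thesis by (simp add: k_free_points_def sieved_def)
  qed
  then show ?thesis by blast
qed

text \<open>The multiples form the subgroup \<open>c ^ k \<Lambda>\<close>, which contains
  \<open>m \<Lambda>\<close>.\<close>

lemma multiples_periodic:
  fixes \<Lambda> :: "(real^'n) set"
  assumes lat: "is_lattice \<Lambda>" and "c ^ k dvd m" and "l \<in> \<Lambda>"
  shows "t + real m *\<^sub>R l \<in> multiples k \<Lambda> c \<longleftrightarrow> t \<in> multiples k \<Lambda> c"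
proof -
  obtain q where m: "m = c ^ k * q" using assms(2) by blast
  have ql: "real q *\<^sub>R l \<in> \<Lambda>" by (rule lattice_scale[OF lat assms(3)])
  have ml: "real m *\<^sub>R l = real (c ^ k) *\<^sub>R (real q *\<^sub>R l)" by (simp add: m)
  show ?thesis
  proof
    assume "t + real m *\<^sub>R l \<in> multiples k \<Lambda> c"
    then obtain x where "x \<in> \<Lambda>" "t + real m *\<^sub>R l = real (c ^ k) *\<^sub>R x"
      unfolding multiples_def by blast
    then have "t = real (c ^ k) *\<^sub>R (x - real q *\<^sub>R l)" unfolding ml
      by (simp add: scaleR_diff_right eq_diff_eq)
    then show "t \<in> multiples k \<Lambda> c"
      unfolding multiples_def using lattice_diff[OF lat \<open>x \<in> \<Lambda>\<close> ql] by blast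
  next
    assume "t \<in> multiples k \<Lambda> c"
    then obtain x where "x \<in> \<Lambda>" "t = real (c ^ k) *\<^sub>R x" unfolding multiples_def by blast
    then have "t + real m *\<^sub>R l = real (c ^ k) *\<^sub>R (x + real q *\<^sub>R l)" unfolding ml
      by (simp add: scaleR_add_right)
    then show "t + real m *\<^sub>R l \<in> multiples k \<Lambda> c"
      unfolding multiples_def using lattice_add[OF lat \<open>x \<in> \<Lambda>\<close> ql] by blast
  qed
qed

text \<open>The number \<open>fact N ^ k\<close> is a common multiple of all \<open>c ^ k\<close>
  used by the sieve.\<close>

lemma sieved_periodic:
  fixes \<Lambda> :: "(real^'n) set"
  assumes lat: "is_lattice \<Lambda>" and l: "l \<in> \<Lambda>"
  shows "t + real (fact N ^ k) *\<^sub>R l \<in> sieved k \<Lambda> N \<longleftrightarrow> t \<in> sieved k \<Lambda> N"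
proof -
  let ?M = "real (fact N ^ k)"
  have Ml: "?M *\<^sub>R l \<in> \<Lambda>" by (rule lattice_scale[OF lat l])
  have "t + ?M *\<^sub>R l \<in> \<Lambda> \<longleftrightarrow> t \<in> \<Lambda>"
    using lattice_add[OF lat _ Ml, of t] lattice_diff[OF lat _ Ml, of "t + ?M *\<^sub>R l"] by auto
  moreover have "t + ?M *\<^sub>R l \<in> multiples k \<Lambda> c \<longleftrightarrow> t \<in> multiples k \<Lambda> c" if "c \<in> {2..N}" for c
  proof (rule multiples_periodic[OF lat _ l])
    have "c dvd fact N" using that by (intro dvd_fact) auto
    then show "c ^ k dvd fact N ^ k" by (rule dvd_power_same)
  qed
  ultimately show ?thesis unfolding sieved_def by blast
qed

text \<open>Telescoping with \<open>1 / c^2 \<le> 1 / (c - 1) - 1 / c\<close>.\<close>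

lemma sum_inverse_squares_le:
  assumes "N \<ge> 1"
  shows "(\<Sum>c\<in>{N<..X}. 1 / real c ^ 2) \<le> 1 / real N"
proof (cases "N \<le> X")
  case True
  then have "(\<Sum>c\<in>{N<..X}. 1 / real c ^ 2) \<le> 1 / real N - 1 / real X"
  proof (induction X rule: dec_induct)
    case base
    then show ?case by simp
  next
    case (step X)
    have "{N<..Suc X} = insert (Suc X) {N<..X}" using step.hyps by auto
    then have "(\<Sum>c\<in>{N<..Suc X}. 1 / real c ^ 2)
        = 1 / real (Suc X) ^ 2 + (\<Sum>c\<in>{N<..X}. 1 / real c ^ 2)" by simp
    also have "\<dots> \<le> 1 / (real X * real (Suc X)) + (1 / real N - 1 / real X)"
      using step assms by (intro add_mono) (auto simp: power2_eq_square intro!: divide_left_mono)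
    also have "1 / (real X * real (Suc X)) = 1 / real X - 1 / real (Suc X)"
      using step.hyps assms by (simp add: divide_simps)
    finally show ?case by simp
  qed
  also have "\<dots> \<le> 1 / real N" by simp
  finally show ?thesis .
next
  case False
  then show ?thesis by simp
qed

text \<open>Scaling turns the nonzero points of \<open>c ^ k \<Lambda>\<close> in a ball of radius
  \<open>R\<close> into those of \<open>\<Lambda>\<close> in a ball of radius
  \<open>R / c ^ k\<close>, of which there are at most \<open>C * R ^ n / c ^ (n * k)\<close>. The
  origin belongs to all these sets and is counted once, by the summand \<open>1\<close>.\<close>

lemma sieve_tail_card_bound:
  fixes \<Lambda> :: "(real^'n) set"
  assumes lat: "is_lattice \<Lambda>" and k: "k \<ge> 1" and nk: "CARD('n) * k \<ge> 2"
  obtains C where "C > 0"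
    "\<And>N R. N \<ge> 1 \<Longrightarrow> R > 0 \<Longrightarrow> finite (sieve_tail k \<Lambda> N \<inter> ball 0 R)"
    "\<And>N R. N \<ge> 1 \<Longrightarrow> R > 0 \<Longrightarrow>
       real (card (sieve_tail k \<Lambda> N \<inter> ball 0 R)) \<le> 1 + C / real N * R ^ CARD('n)"
proof -
  let ?n = "CARD('n)"
  obtain C where C: "C > 0"
    "\<And>r. r > 0 \<Longrightarrow> real (card (\<Lambda> \<inter> ball 0 r - {0})) \<le> C * r ^ CARD('n)"
    using lattice_ball_card_bound[OF lat] by blast
  obtain s where s: "s > 0" "\<And>x. x \<in> \<Lambda> \<Longrightarrow> x \<noteq> 0 \<Longrightarrow> s \<le> norm x"
    using lattice_separated[OF lat] by blast
  show thesis
  proof (rule that[OF C(1)])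
    fix N :: nat and R :: real assume N: "N \<ge> 1" and R: "R > 0"
    show "finite (sieve_tail k \<Lambda> N \<inter> ball 0 R)"
    proof (rule rev_finite_subset[OF finite_lattice_ball[OF lat, of R]])
      show "sieve_tail k \<Lambda> N \<inter> ball 0 R \<subseteq> \<Lambda> \<inter> ball 0 R"
        using lattice_scale[OF lat] unfolding sieve_tail_def multiples_def by blast
    qed
    \<comment> \<open>A nonzero point of \<open>c ^ k \<Lambda>\<close> has norm at least
      \<open>c * s\<close>, so only \<open>c \<le> X\<close> contribute nonzero points to the
      ball.\<close>
    define X where "X = nat \<lceil>R / s\<rceil>"
    define S where "S c = (*\<^sub>R) (real (c ^ k)) ` (\<Lambda> \<inter> ball 0 (R / real (c ^ k)) - {0})" for c
    have finS: "finite (S c)" for c unfolding S_def using finite_lattice_ball[OF lat] by blast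
    have sub: "sieve_tail k \<Lambda> N \<inter> ball 0 R \<subseteq> insert 0 (\<Union>c\<in>{N<..X}. S c)"
    proof
      fix y assume y: "y \<in> sieve_tail k \<Lambda> N \<inter> ball 0 R"
      then obtain c x where c: "c > N" and x: "x \<in> \<Lambda>" "y = real (c ^ k) *\<^sub>R x"
        unfolding sieve_tail_def multiples_def by blast
      have cpos: "real (c ^ k) > 0" using c by simp
      have yR: "real (c ^ k) * norm x < R" using y x cpos by simp
      show "y \<in> insert 0 (\<Union>c\<in>{N<..X}. S c)"
      proof (cases "x = 0")
        case True
        then show ?thesis using x by simp
      next
        case False
        have "real c \<le> real (c ^ k)" using le_self_power[OF k, of c] by (simp only: of_nat_le_iff)
        then have "real c * s \<le> real (c ^ k) * norm x"
          using s x False by (intro mult_mono) auto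
        then have "real c * s < R" using yR by linarith
        then have "real c < R / s" using s by (simp add: pos_less_divide_eq)
        then have "c \<le> X" unfolding X_def by linarith
        moreover have "x \<in> \<Lambda> \<inter> ball 0 (R / real (c ^ k)) - {0}"
          using x False yR cpos by (simp add: pos_less_divide_eq mult.commute)
        ultimately have "c \<in> {N<..X}" "y \<in> S c" using c x(2) unfolding S_def by auto
        then show ?thesis by blast
      qed
    qed
    have "card (sieve_tail k \<Lambda> N \<inter> ball 0 R) \<le> card (insert 0 (\<Union>c\<in>{N<..X}. S c))"
      using finS by (intro card_mono sub) auto
    also have "\<dots> \<le> Suc (card (\<Union>c\<in>{N<..X}. S c))" using finS by (simp add: card_insert_if)
    also have "\<dots> \<le> Suc (\<Sum>c\<in>{N<..X}. card (S c))"
      by (intro Suc_leI le_imp_less_Suc card_UN_le) auto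
    finally have "real (card (sieve_tail k \<Lambda> N \<inter> ball 0 R)) \<le> 1 + (\<Sum>c\<in>{N<..X}. real (card (S c)))"
      by (metis of_nat_Suc of_nat_le_iff of_nat_sum add.commute)
    also have "(\<Sum>c\<in>{N<..X}. real (card (S c))) \<le> (\<Sum>c\<in>{N<..X}. C * R ^ ?n * (1 / real c ^ 2))"
    proof (rule sum_mono)
      fix c assume c: "c \<in> {N<..X}"
      then have cpos: "real (c ^ k) > 0" "real c \<ge> 1" by auto
      have "card (S c) \<le> card (\<Lambda> \<inter> ball 0 (R / real (c ^ k)) - {0})"
        unfolding S_def using finite_lattice_ball[OF lat] by (intro card_image_le) blast
      then have "real (card (S c)) \<le> C * (R / real (c ^ k)) ^ ?n"
        using C(2)[of "R / real (c ^ k)"] R cpos by (meson divide_pos_pos of_nat_le_iff order_trans)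
      also have "\<dots> = C * R ^ ?n * (1 / real c ^ (?n * k))"
        by (simp add: power_divide power_mult[symmetric] mult.commute[of k])
      \<comment> \<open>Here the assumption \<open>n * k \<ge> 2\<close> makes the sum over
        \<open>c\<close> converge.\<close>
      also have "\<dots> \<le> C * R ^ ?n * (1 / real c ^ 2)"
        using C(1) R cpos nk by (intro mult_left_mono divide_left_mono power_increasing) auto
      finally show "real (card (S c)) \<le> C * R ^ ?n * (1 / real c ^ 2)" .
    qed
    also have "\<dots> \<le> C * R ^ ?n * (1 / real N)"
      unfolding sum_distrib_left[symmetric]
      using sum_inverse_squares_le[OF N] C(1) R by (intro mult_left_mono) auto
    finally show "real (card (sieve_tail k \<Lambda> N \<inter> ball 0 R)) \<le> 1 + C / real N * R ^ ?n"
      by (simp add: mult.commute)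
  qed
qed

subsection \<open>Approximation of the patches\<close>

text \<open>An interchange of limits: the errors \<open>e N + e M\<close> bound the distances of the
  \<open>d N\<close>, which therefore form a Cauchy sequence, and \<open>f\<close> tends to its
  limit by a three-epsilon argument.\<close>

lemma convergent_if_approximable:
  fixes f :: "real \<Rightarrow> real" and g :: "nat \<Rightarrow> real \<Rightarrow> real"
  assumes g: "\<And>N. (g N \<longlongrightarrow> d N) at_top"
    and close: "\<And>N. \<forall>\<^sub>F R in at_top. \<bar>f R - g N R\<bar> \<le> e N"
    and e: "e \<longlonglongrightarrow> 0"
  shows "\<exists>L. (f \<longlongrightarrow> L) at_top"
proof -
  have dd: "\<bar>d N - d M\<bar> \<le> e N + e M" for N M
  proof (rule tendsto_upperbound)
    show "((\<lambda>R. \<bar>g N R - g M R\<bar>) \<longlongrightarrow> \<bar>d N - d M\<bar>) at_top"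
      by (intro tendsto_rabs tendsto_diff g)
    show "\<forall>\<^sub>F R in at_top. \<bar>g N R - g M R\<bar> \<le> e N + e M"
      using close[of N] close[of M] by eventually_elim linarith
  qed simp
  have small: "\<exists>N0. \<forall>N\<ge>N0. e N < r" if "r > 0" for r
    using order_tendstoD(2)[OF e that] by (simp add: eventually_sequentially)
  have "Cauchy d"
  proof (rule metric_CauchyI)
    fix r :: real assume "r > 0"
    then obtain N0 where N0: "\<And>N. N \<ge> N0 \<Longrightarrow> e N < r / 2" using small[of "r / 2"] by auto
    have "dist (d m) (d n) < r" if "m \<ge> N0" "n \<ge> N0" for m n
      using dd[of m n] N0[OF that(1)] N0[OF that(2)] unfolding dist_real_def by linarith
    then show "\<exists>M. \<forall>m\<ge>M. \<forall>n\<ge>M. dist (d m) (d n) < r" by blast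
  qed
  then obtain L where L: "d \<longlonglongrightarrow> L" using Cauchy_convergent convergent_def by blast
  have "(f \<longlongrightarrow> L) at_top"
  proof (rule tendstoI)
    fix r :: real assume r: "r > 0"
    have "\<forall>\<^sub>F N in sequentially. e N < r / 3" using order_tendstoD(2)[OF e, of "r / 3"] r by simp
    moreover have "\<forall>\<^sub>F N in sequentially. dist (d N) L < r / 3" using tendstoD[OF L, of "r / 3"] r by simp
    ultimately have "\<forall>\<^sub>F N in sequentially. e N < r / 3 \<and> dist (d N) L < r / 3"
      by (rule eventually_conj)
    then obtain N where N: "e N < r / 3" "dist (d N) L < r / 3"
      using eventually_happens by fastforce
    have "\<forall>\<^sub>F R in at_top. dist (g N R) (d N) < r / 3" using tendstoD[OF g, of "r / 3" N] r by simp
    then show "\<forall>\<^sub>F R in at_top. dist (f R) L < r"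
      using close[of N]
    proof eventually_elim
      case (elim R)
      then show ?case using N unfolding dist_real_def by linarith
    qed
  qed
  then show ?thesis ..
qed

text \<open>Gibbs' inequality, termwise from \<open>ln x \<le> x - 1\<close>. The total weight of
  \<open>q\<close> remains as an error term because the two families need not have the same
  total.\<close>

lemma entropy_le_cross_entropy:
  fixes \<nu> q :: "'a \<Rightarrow> real"
  assumes "\<And>x. x \<in> S \<Longrightarrow> \<nu> x \<ge> 0" "\<And>x. x \<in> S \<Longrightarrow> q x > 0"
  shows "(\<Sum>x\<in>S. - \<nu> x * ln (\<nu> x)) \<le> (\<Sum>x\<in>S. \<nu> x * - ln (q x)) + (\<Sum>x\<in>S. q x)"
  unfolding sum.distrib[symmetric]
proof (rule sum_mono)
  fix x assume x: "x \<in> S"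
  show "- \<nu> x * ln (\<nu> x) \<le> \<nu> x * - ln (q x) + q x"
  proof (cases "\<nu> x = 0")
    case True
    then show ?thesis using assms(2)[OF x] by simp
  next
    case False
    then have \<nu>: "\<nu> x > 0" using assms(1)[OF x] by simp
    have "ln (q x / \<nu> x) \<le> q x / \<nu> x - 1"
      using \<nu> assms(2)[OF x] by (intro ln_le_minus_one) simp
    then have "\<nu> x * ln (q x / \<nu> x) \<le> \<nu> x * (q x / \<nu> x - 1)"
      using \<nu> by (intro mult_left_mono) auto
    also have "\<dots> = q x - \<nu> x" using \<nu> by (simp add: right_diff_distrib)
    finally show ?thesis using \<nu> assms(2)[OF x] by (simp add: ln_div right_diff_distrib)
  qed
qed

text \<open>The binomial expansion, subset by subset. It gives the total weight of all sets of
  missing points when each point costs a factor \<open>x\<close>.\<close>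

lemma sum_power_card_Pow:
  fixes x :: real
  assumes "finite A"
  shows "(\<Sum>S\<in>Pow A. x ^ card S) = (1 + x) ^ card A"
  using prod_add[OF assms, of "\<lambda>_. x" "\<lambda>_. 1"] by (simp add: add.commute)

section \<open>Patches and the points missing from them\<close>

lemma patch_iff: "x \<in> patch V \<rho> t \<longleftrightarrow> x + t \<in> V \<and> x \<in> ball 0 \<rho>"
proof -
  have "x \<in> (\<lambda>v. v - t) ` V \<longleftrightarrow> x + t \<in> V"
  proof
    assume "x + t \<in> V"
    moreover have "x = (x + t) - t" by simp
    ultimately show "x \<in> (\<lambda>v. v - t) ` V" by blast
  qed auto
  then show ?thesis by (simp add: patch_def)
qed

lemma finite_patches:
  fixes \<Lambda> :: "(real^'n) set"
  assumes lat: "is_lattice \<Lambda>" and V: "V \<subseteq> \<Lambda>"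
  shows "finite (patches \<Lambda> V \<rho>)"
proof -
  have "patches \<Lambda> V \<rho> \<subseteq> Pow (\<Lambda> \<inter> ball 0 \<rho>)"
  proof
    fix P assume "P \<in> patches \<Lambda> V \<rho>"
    then obtain t where t: "t \<in> \<Lambda>" "P = patch V \<rho> t" unfolding patches_def by blast
    have "P \<subseteq> \<Lambda> \<inter> ball 0 \<rho>"
    proof
      fix x assume "x \<in> P"
      then have "x + t \<in> \<Lambda>" "x \<in> ball 0 \<rho>" using V unfolding t patch_iff by auto
      then show "x \<in> \<Lambda> \<inter> ball 0 \<rho>" using lattice_diff[OF lat _ t(1), of "x + t"] by simp
    qed
    then show "P \<in> Pow (\<Lambda> \<inter> ball 0 \<rho>)" by blast
  qed
  then show ?thesis using finite_lattice_ball[OF lat] finite_subset by blast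
qed

text \<open>Positions that the sieved set leaves vacant anyway are included, so that the count of
  missing points depends on the tail alone.\<close>

definition missing :: "nat \<Rightarrow> (real^'n) set \<Rightarrow> nat \<Rightarrow> real \<Rightarrow> real^'n \<Rightarrow> (real^'n) set" where
  "missing k \<Lambda> N \<rho> t = {l \<in> \<Lambda> \<inter> ball 0 \<rho>. l + t \<in> sieve_tail k \<Lambda> N}"

lemma finite_missing:
  fixes \<Lambda> :: "(real^'n) set"
  assumes "is_lattice \<Lambda>"
  shows "finite (missing k \<Lambda> N \<rho> t)"
  unfolding missing_def using finite_lattice_ball[OF assms] by (rule rev_finite_subset) blast

lemma patch_k_free_points:
  fixes \<Lambda> :: "(real^'n) set"
  assumes lat: "is_lattice \<Lambda>" and k: "k \<ge> 1" and N: "N \<ge> 1" and t: "t \<in> \<Lambda>"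
  shows "patch (k_free_points k \<Lambda>) \<rho> t = patch (sieved k \<Lambda> N) \<rho> t - missing k \<Lambda> N \<rho> t"
proof (rule set_eqI)
  fix x
  have "x + t \<in> sieved k \<Lambda> N \<Longrightarrow> x \<in> \<Lambda>"
    using lattice_diff[OF lat _ t, of "x + t"] by (auto simp: sieved_def)
  then show "x \<in> patch (k_free_points k \<Lambda>) \<rho> t
      \<longleftrightarrow> x \<in> patch (sieved k \<Lambda> N) \<rho> t - missing k \<Lambda> N \<rho> t"
    unfolding Diff_iff patch_iff k_free_points_eq[OF lat k N] missing_def by blast
qed

text \<open>Double counting of the pairs \<open>(t, l)\<close> with \<open>l + t\<close> in the
  tail: for fixed \<open>l\<close> the map from \<open>t\<close> to \<open>l + t\<close> is
  injective, with values in the ball of radius \<open>R + \<rho>\<close>.\<close>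

lemma sum_card_missing_le:
  fixes \<Lambda> :: "(real^'n) set"
  assumes lat: "is_lattice \<Lambda>" and R: "R > 0" and \<rho>: "\<rho> > 0"
    and fin: "finite (sieve_tail k \<Lambda> N \<inter> ball 0 (R + \<rho>))"
  shows "(\<Sum>t\<in>\<Lambda> \<inter> ball 0 R. card (missing k \<Lambda> N \<rho> t))
     \<le> card (\<Lambda> \<inter> ball 0 \<rho>) * card (sieve_tail k \<Lambda> N \<inter> ball 0 (R + \<rho>))"
proof -
  let ?A = "\<Lambda> \<inter> ball 0 R" and ?B = "\<Lambda> \<inter> ball 0 \<rho>" and ?T = "sieve_tail k \<Lambda> N"
  have finA: "finite ?A" and finB: "finite ?B" using finite_lattice_ball[OF lat] by auto
  have "(\<Sum>t\<in>?A. card (missing k \<Lambda> N \<rho> t)) = (\<Sum>t\<in>?A. \<Sum>l\<in>?B. if l + t \<in> ?T then 1 else 0)"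
    unfolding missing_def using finB by (intro sum.cong refl) (simp add: sum.If_cases Int_def)
  also have "\<dots> = (\<Sum>l\<in>?B. \<Sum>t\<in>?A. if l + t \<in> ?T then 1 else 0)" by (rule sum.swap)
  also have "\<dots> = (\<Sum>l\<in>?B. card {t \<in> ?A. l + t \<in> ?T})"
    using finA by (intro sum.cong refl) (simp add: sum.If_cases Int_def)
  also have "\<dots> \<le> (\<Sum>l\<in>?B. card (?T \<inter> ball 0 (R + \<rho>)))"
  proof (rule sum_mono)
    fix l assume l: "l \<in> ?B"
    have "(+) l ` {t \<in> ?A. l + t \<in> ?T} \<subseteq> ?T \<inter> ball 0 (R + \<rho>)"
    proof safe
      fix t :: "real^'n" assume t: "t \<in> ball 0 R"
      have "norm (l + t) \<le> norm l + norm t" by (rule norm_triangle_ineq)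
      then show "l + t \<in> ball 0 (R + \<rho>)" using l t by simp
    qed
    then show "card {t \<in> ?A. l + t \<in> ?T} \<le> card (?T \<inter> ball 0 (R + \<rho>))"
      using fin by (intro card_inj_on_le[of "(+) l"]) auto
  qed
  also have "\<dots> = card ?B * card (?T \<inter> ball 0 (R + \<rho>))" by simp
  finally show ?thesis .
qed

text \<open>The double count is divided by the volume of the ball: the contribution of the origin
  tends to \<open>0\<close> and \<open>(R + \<rho>) / R\<close> tends to \<open>1\<close>. Taking
  \<open>b\<close> strictly above the limit gives an eventual bound. The constant is uniform in
  \<open>N\<close> and \<open>\<rho>\<close>.\<close>

lemma mean_card_missing:
  fixes \<Lambda> :: "(real^'n) set"
  assumes lat: "is_lattice \<Lambda>" and k: "k \<ge> 1" and nk: "CARD('n) * k \<ge> 2"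
  obtains C where "C > 0"
    "\<And>N \<rho> b. N \<ge> 1 \<Longrightarrow> \<rho> > 0 \<Longrightarrow> b > real (card (\<Lambda> \<inter> ball 0 \<rho>)) * C / real N \<Longrightarrow>
       \<forall>\<^sub>F R in at_top. (\<Sum>t\<in>\<Lambda> \<inter> ball 0 R. real (card (missing k \<Lambda> N \<rho> t)))
          / (R ^ CARD('n) * unit_ball_vol (real CARD('n))) \<le> b"
proof -
  let ?n = "CARD('n)" and ?v = "unit_ball_vol (real CARD('n))"
  have v: "?v > 0" by simp
  obtain C where C: "C > 0"
    "\<And>N R. N \<ge> 1 \<Longrightarrow> R > 0 \<Longrightarrow> finite (sieve_tail k \<Lambda> N \<inter> ball 0 R)"
    "\<And>N R. N \<ge> 1 \<Longrightarrow> R > 0 \<Longrightarrow>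
       real (card (sieve_tail k \<Lambda> N \<inter> ball 0 R)) \<le> 1 + C / real N * R ^ CARD('n)"
    using sieve_tail_card_bound[OF lat k nk] by blast
  show thesis
  \<comment> \<open>The new constant absorbs the volume of the unit ball in the denominator.\<close>
  proof (rule that[of "C / ?v"])
    show "C / ?v > 0" using C v by simp
    fix N :: nat and \<rho> b :: real
    assume N: "N \<ge> 1" and \<rho>: "\<rho> > 0" and b: "b > real (card (\<Lambda> \<inter> ball 0 \<rho>)) * (C / ?v) / real N"
    let ?m = "real (card (\<Lambda> \<inter> ball 0 \<rho>))"
    have "((\<lambda>R. ?m * (inverse R ^ ?n + C / real N * ((R + \<rho>) / R) ^ ?n) / ?v)
        \<longlongrightarrow> ?m * (0 ^ ?n + C / real N * 1) / ?v) at_top"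
      by (intro tendsto_mult tendsto_divide tendsto_add tendsto_const tendsto_power
          tendsto_inverse_0_at_top filterlim_ident tendsto_shift_ratio_power) (use v in linarith)
    moreover have "?m * (0 ^ ?n + C / real N * 1) / ?v < b" using b by (simp add: zero_power mult.commute)
    ultimately have "\<forall>\<^sub>F R in at_top. ?m * (inverse R ^ ?n + C / real N * ((R + \<rho>) / R) ^ ?n) / ?v < b"
      by (rule order_tendstoD(2))
    then show "\<forall>\<^sub>F R in at_top. (\<Sum>t\<in>\<Lambda> \<inter> ball 0 R. real (card (missing k \<Lambda> N \<rho> t)))
          / (R ^ CARD('n) * unit_ball_vol (real CARD('n))) \<le> b"
      using eventually_gt_at_top[of 0]
    proof eventually_elim
      case (elim R)
      have R\<rho>: "R + \<rho> > 0" using elim \<rho> by simp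
      have "(\<Sum>t\<in>\<Lambda> \<inter> ball 0 R. real (card (missing k \<Lambda> N \<rho> t)))
          = real (\<Sum>t\<in>\<Lambda> \<inter> ball 0 R. card (missing k \<Lambda> N \<rho> t))" by simp
      also have "\<dots> \<le> real (card (\<Lambda> \<inter> ball 0 \<rho>) * card (sieve_tail k \<Lambda> N \<inter> ball 0 (R + \<rho>)))"
        using sum_card_missing_le[OF lat elim(2) \<rho> C(2)[OF N R\<rho>]] by (simp only: of_nat_le_iff)
      also have "\<dots> \<le> ?m * (1 + C / real N * (R + \<rho>) ^ ?n)"
        unfolding of_nat_mult using C(3)[OF N R\<rho>] by (intro mult_left_mono) auto
      finally have "(\<Sum>t\<in>\<Lambda> \<inter> ball 0 R. real (card (missing k \<Lambda> N \<rho> t))) / (R ^ ?n * ?v)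
          \<le> ?m * (1 + C / real N * (R + \<rho>) ^ ?n) / (R ^ ?n * ?v)"
        using elim v by (intro divide_right_mono) auto
      also have "\<dots> = ?m * (inverse R ^ ?n + C / real N * ((R + \<rho>) / R) ^ ?n) / ?v"
      proof -
        have "(1 + C / real N * (R + \<rho>) ^ ?n) / R ^ ?n
            = inverse R ^ ?n + C / real N * ((R + \<rho>) / R) ^ ?n"
          by (simp add: add_divide_distrib[of 1] power_divide inverse_eq_divide)
        then show ?thesis by (metis divide_divide_eq_left times_divide_eq_right)
      qed
      also have "\<dots> \<le> b" using elim by simp
      finally show ?case .
    qed
  qed
qed

text \<open>Grouping the locations by their patch turns a weighted sum over patches into an average
  over locations, where weights of patches can be compared with quantities that depend on the
  location.\<close>

lemma sum_patches_normalized_count: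
  fixes \<Lambda> :: "(real^'n) set"
  assumes lat: "is_lattice \<Lambda>" and V: "V \<subseteq> \<Lambda>"
  shows "(\<Sum>P\<in>patches \<Lambda> V \<rho>. normalized_count (patch_locations \<Lambda> V \<rho> P) R * w P)
    = (\<Sum>t\<in>\<Lambda> \<inter> ball 0 R. w (patch V \<rho> t)) / (R ^ CARD('n) * unit_ball_vol (real CARD('n)))"
proof -
  let ?D = "R ^ CARD('n) * unit_ball_vol (real CARD('n))"
  have "(\<Sum>t\<in>\<Lambda> \<inter> ball 0 R. w (patch V \<rho> t))
      = (\<Sum>P\<in>patches \<Lambda> V \<rho>. \<Sum>t\<in>{t \<in> \<Lambda> \<inter> ball 0 R. patch V \<rho> t = P}. w (patch V \<rho> t))"
    by (rule sum.group[symmetric])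
       (auto simp: patches_def finite_lattice_ball[OF lat] finite_patches[OF lat V, unfolded patches_def])
  also have "\<dots> = (\<Sum>P\<in>patches \<Lambda> V \<rho>. real (card (patch_locations \<Lambda> V \<rho> P \<inter> ball 0 R)) * w P)"
  proof (rule sum.cong[OF refl])
    fix P
    have "{t \<in> \<Lambda> \<inter> ball 0 R. patch V \<rho> t = P} = patch_locations \<Lambda> V \<rho> P \<inter> ball 0 R"
      by (auto simp: patch_locations_def)
    then show "(\<Sum>t\<in>{t \<in> \<Lambda> \<inter> ball 0 R. patch V \<rho> t = P}. w (patch V \<rho> t))
        = real (card (patch_locations \<Lambda> V \<rho> P \<inter> ball 0 R)) * w P"
      by (simp add: patch_locations_def)
  qed
  finally show ?thesis by (simp add: normalized_count_def sum_divide_distrib)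
qed

text \<open>For the sieved sets the locations of \<open>P\<close> are periodic and have a density.
  They differ from those for the k-free points only where some point is missing, and the frequency
  of such locations is at most the mean number of missing points, which is
  \<open>O(1 / N)\<close>.\<close>

lemma patch_locations_density:
  fixes \<Lambda> :: "(real^'n) set"
  assumes lat: "is_lattice \<Lambda>" and k: "k \<ge> 1" and nk: "CARD('n) * k \<ge> 2" and \<rho>: "\<rho> > 0"
  shows "\<exists>d. has_density (patch_locations \<Lambda> (k_free_points k \<Lambda>) \<rho> P) d"
proof -
  let ?n = "CARD('n)" and ?v = "unit_ball_vol (real CARD('n))"
  have v: "?v > 0" by simp
  obtain C where C: "C > 0"
    "\<And>N \<rho> b. N \<ge> 1 \<Longrightarrow> \<rho> > 0 \<Longrightarrow> b > real (card (\<Lambda> \<inter> ball 0 \<rho>)) * C / real N \<Longrightarrow>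
       \<forall>\<^sub>F R in at_top. (\<Sum>t\<in>\<Lambda> \<inter> ball 0 R. real (card (missing k \<Lambda> N \<rho> t)))
          / (R ^ CARD('n) * unit_ball_vol (real CARD('n))) \<le> b"
    using mean_card_missing[OF lat k nk] by blast
  \<comment> \<open>The summand \<open>1\<close> provides the strict inequality that the bound on
    the mean requires.\<close>
  define K where "K = real (card (\<Lambda> \<inter> ball 0 \<rho>)) * C + 1"
  let ?Z = "patch_locations \<Lambda> (k_free_points k \<Lambda>) \<rho> P"
  \<comment> \<open>The index is shifted so that the sieve level is at least
    \<open>1\<close>.\<close>
  define Y where "Y N = patch_locations \<Lambda> (sieved k \<Lambda> (Suc N)) \<rho> P" for N
  have "\<exists>d. has_density (Y N) d" for N
  proof (rule periodic_density[OF lat])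
    let ?M = "fact (Suc N) ^ k :: nat"
    show "?M \<ge> 1" by (intro one_le_power fact_ge_1)
    show "Y N \<subseteq> \<Lambda>" by (auto simp: Y_def patch_locations_def)
    fix t l assume t: "t \<in> \<Lambda>" and l: "l \<in> \<Lambda>"
    have "patch (sieved k \<Lambda> (Suc N)) \<rho> (t + real ?M *\<^sub>R l) = patch (sieved k \<Lambda> (Suc N)) \<rho> t"
      using sieved_periodic[OF lat l, of _ "Suc N" k]
      by (intro set_eqI) (simp only: patch_iff add.assoc[symmetric])
    moreover have "t + real ?M *\<^sub>R l \<in> \<Lambda>" using lattice_add[OF lat t lattice_scale[OF lat l]] .
    ultimately show "t + real ?M *\<^sub>R l \<in> Y N \<longleftrightarrow> t \<in> Y N"
      using t unfolding Y_def patch_locations_def by simp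
  qed
  then obtain d where d: "\<And>N. has_density (Y N) (d N)" by metis
  have "\<exists>L. (normalized_count ?Z \<longlongrightarrow> L) at_top"
  proof (rule convergent_if_approximable)
    show "(normalized_count (Y N) \<longlongrightarrow> d N) at_top" for N using d by (simp add: has_density_iff)
    show "(\<lambda>N. K / real (Suc N)) \<longlonglongrightarrow> 0"
      by (rule LIMSEQ_Suc[OF lim_const_over_n])
    fix N
    have "K / real (Suc N) > real (card (\<Lambda> \<inter> ball 0 \<rho>)) * C / real (Suc N)"
      unfolding K_def by (rule divide_strict_right_mono) auto
    then have "\<forall>\<^sub>F R in at_top. (\<Sum>t\<in>\<Lambda> \<inter> ball 0 R. real (card (missing k \<Lambda> (Suc N) \<rho> t)))
          / (R ^ ?n * ?v) \<le> K / real (Suc N)"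
      using C(2) \<rho> by simp
    then show "\<forall>\<^sub>F R in at_top. \<bar>normalized_count ?Z R - normalized_count (Y N) R\<bar> \<le> K / real (Suc N)"
      using eventually_gt_at_top[of 0]
    proof eventually_elim
      case (elim R)
      \<comment> \<open>Outside \<open>H\<close> the two patches agree. Each element of
        \<open>H\<close> contributes at least \<open>1\<close> to the total number of missing
        points, as in Markov's inequality.\<close>
      define H where "H = {t \<in> \<Lambda> \<inter> ball 0 R. missing k \<Lambda> (Suc N) \<rho> t \<noteq> {}}"
      have finA: "finite (\<Lambda> \<inter> ball 0 R)" by (rule finite_lattice_ball[OF lat])
      have finH: "finite H" unfolding H_def by (rule rev_finite_subset[OF finA]) blast
      have eq: "t \<in> ?Z \<longleftrightarrow> t \<in> Y N" if "t \<in> \<Lambda> \<inter> ball 0 R" "t \<notin> H" for t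
        using that patch_k_free_points[OF lat k, of "Suc N" t \<rho>]
        unfolding H_def Y_def patch_locations_def by auto
      have sub: "?Z \<inter> ball 0 R \<subseteq> (Y N \<inter> ball 0 R) \<union> H" "Y N \<inter> ball 0 R \<subseteq> (?Z \<inter> ball 0 R) \<union> H"
        using eq unfolding Y_def patch_locations_def by blast+
      have fin: "finite (?Z \<inter> ball 0 R)" "finite (Y N \<inter> ball 0 R)"
        using finA by (auto simp: Y_def patch_locations_def elim!: rev_finite_subset)
      have "card (?Z \<inter> ball 0 R) \<le> card (Y N \<inter> ball 0 R) + card H"
        using card_mono[OF _ sub(1)] fin finH card_Un_le[of "Y N \<inter> ball 0 R" H] by fastforce
      moreover have "card (Y N \<inter> ball 0 R) \<le> card (?Z \<inter> ball 0 R) + card H"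
        using card_mono[OF _ sub(2)] fin finH card_Un_le[of "?Z \<inter> ball 0 R" H] by fastforce
      ultimately have "\<bar>real (card (?Z \<inter> ball 0 R)) - real (card (Y N \<inter> ball 0 R))\<bar> \<le> real (card H)"
        by linarith
      also have "real (card H) = (\<Sum>t\<in>H. 1)" by simp
      also have "\<dots> \<le> (\<Sum>t\<in>H. real (card (missing k \<Lambda> (Suc N) \<rho> t)))"
      proof (rule sum_mono)
        fix t assume "t \<in> H"
        then have "card (missing k \<Lambda> (Suc N) \<rho> t) > 0"
          using finite_missing[OF lat] by (simp add: H_def card_gt_0_iff)
        then show "1 \<le> real (card (missing k \<Lambda> (Suc N) \<rho> t))" by simp
      qed
      also have "\<dots> \<le> (\<Sum>t\<in>\<Lambda> \<inter> ball 0 R. real (card (missing k \<Lambda> (Suc N) \<rho> t)))"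
        using finA by (intro sum_mono2) (auto simp: H_def)
      finally have "\<bar>real (card (?Z \<inter> ball 0 R)) - real (card (Y N \<inter> ball 0 R))\<bar> / (R ^ ?n * ?v)
          \<le> (\<Sum>t\<in>\<Lambda> \<inter> ball 0 R. real (card (missing k \<Lambda> (Suc N) \<rho> t))) / (R ^ ?n * ?v)"
        using elim v by (intro divide_right_mono) auto
      also note elim(1)
      finally show ?case
        using elim(2) by (simp add: normalized_count_def diff_divide_distrib[symmetric] abs_mult)
    qed
  qed
  then show ?thesis by (simp add: has_density_iff)
qed

text \<open>By periodicity the translate depends only on the residue class of \<open>t\<close>.
  Taking whole translates instead of their patches makes the number of them independent of the
  radius.\<close>

lemma finite_sieved_translates:
  fixes \<Lambda> :: "(real^'n) set"
  assumes lat: "is_lattice \<Lambda>"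
  shows "finite ((\<lambda>t. {x. x + t \<in> sieved k \<Lambda> N}) ` \<Lambda>)"
proof -
  let ?M = "fact N ^ k :: nat"
  have "?M \<ge> 1" by (intro one_le_power fact_ge_1)
  from lattice_residues[OF lat this] obtain F where F: "finite F"
    "\<And>t. t \<in> \<Lambda> \<Longrightarrow> \<exists>r\<in>F. \<exists>l\<in>\<Lambda>. t = r + real ?M *\<^sub>R l" by metis
  have "(\<lambda>t. {x. x + t \<in> sieved k \<Lambda> N}) ` \<Lambda> \<subseteq> (\<lambda>t. {x. x + t \<in> sieved k \<Lambda> N}) ` F"
  proof safe
    fix t assume "t \<in> \<Lambda>"
    then obtain r l where rl: "r \<in> F" "l \<in> \<Lambda>" "t = r + real ?M *\<^sub>R l" using F(2) by blast
    have "{x. x + t \<in> sieved k \<Lambda> N} = {x. x + r \<in> sieved k \<Lambda> N}"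
      using sieved_periodic[OF lat rl(2), of _ N k]
      unfolding rl(3) by (simp only: add.assoc[symmetric])
    then show "{x. x + t \<in> sieved k \<Lambda> N} \<in> (\<lambda>t. {x. x + t \<in> sieved k \<Lambda> N}) ` F"
      using rl(1) by blast
  qed
  then show ?thesis using F(1) finite_surj by blast
qed

subsection \<open>Entropy\<close>

lemma density_nonneg:
  assumes "has_density Y d"
  shows "d \<ge> 0"
proof (rule tendsto_lowerbound)
  show "(normalized_count Y \<longlongrightarrow> d) at_top" using assms by (simp add: has_density_iff)
  show "\<forall>\<^sub>F R in at_top. 0 \<le> normalized_count Y R"
    using eventually_gt_at_top[of 0] by eventually_elim (rule normalized_count_nonneg)
qed simp

text \<open>The order of the quantifiers matters: \<open>C\<close> is uniform in \<open>N\<close>,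
  and \<open>K\<close> depends on \<open>N\<close> but not on \<open>\<rho>\<close> or
  \<open>\<epsilon>\<close>, so it disappears after division by the volume. The factor
  \<open>d\<close> is the total frequency of all patches.\<close>

lemma patch_entropy_bound:
  fixes \<Lambda> :: "(real^'n) set"
  assumes lat: "is_lattice \<Lambda>" and k: "k \<ge> 1" and nk: "CARD('n) * k \<ge> 2"
    and d: "has_density \<Lambda> d"
  obtains C where "C > 0"
    "\<And>N. N \<ge> 1 \<Longrightarrow> \<exists>K. \<forall>\<rho>>0. \<forall>\<epsilon>. 0 < \<epsilon> \<and> \<epsilon> < 1 \<longrightarrow>
       (\<Sum>P\<in>patches \<Lambda> (k_free_points k \<Lambda>) \<rho>.
          - patch_frequency \<Lambda> (k_free_points k \<Lambda>) \<rho> P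
            * ln (patch_frequency \<Lambda> (k_free_points k \<Lambda>) \<rho> P))
       \<le> ln (1 / \<epsilon>) * (real (card (\<Lambda> \<inter> ball 0 \<rho>)) * C / real N + 1)
          + (K + real (card (\<Lambda> \<inter> ball 0 \<rho>)) * ln (1 + \<epsilon>)) * d + 1"
proof -
  let ?n = "CARD('n)" and ?v = "unit_ball_vol (real CARD('n))" and ?V = "k_free_points k \<Lambda>"
  have v: "?v > 0" by simp
  obtain C where C: "C > 0"
    "\<And>N \<rho> b. N \<ge> 1 \<Longrightarrow> \<rho> > 0 \<Longrightarrow> b > real (card (\<Lambda> \<inter> ball 0 \<rho>)) * C / real N \<Longrightarrow>
       \<forall>\<^sub>F R in at_top. (\<Sum>t\<in>\<Lambda> \<inter> ball 0 R. real (card (missing k \<Lambda> N \<rho> t)))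
          / (R ^ CARD('n) * unit_ball_vol (real CARD('n))) \<le> b"
    using mean_card_missing[OF lat k nk] by blast
  have V: "?V \<subseteq> \<Lambda>" by (auto simp: k_free_points_def)
  have "\<exists>K. \<forall>\<rho>>0. \<forall>\<epsilon>. 0 < \<epsilon> \<and> \<epsilon> < 1 \<longrightarrow>
       (\<Sum>P\<in>patches \<Lambda> ?V \<rho>. - patch_frequency \<Lambda> ?V \<rho> P * ln (patch_frequency \<Lambda> ?V \<rho> P))
       \<le> ln (1 / \<epsilon>) * (real (card (\<Lambda> \<inter> ball 0 \<rho>)) * C / real N + 1)
          + (K + real (card (\<Lambda> \<inter> ball 0 \<rho>)) * ln (1 + \<epsilon>)) * d + 1" if N: "N \<ge> 1" for N
  proof (intro exI allI impI)
    fix \<rho> \<epsilon> :: real assume \<rho>: "\<rho> > 0" and "0 < \<epsilon> \<and> \<epsilon> < 1"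
    then have \<epsilon>: "0 < \<epsilon>" "\<epsilon> < 1" by auto
    define sv where "sv t = {x. x + t \<in> sieved k \<Lambda> N}" for t
    define Q where "Q = sv ` \<Lambda>"
    define B where "B = \<Lambda> \<inter> ball 0 \<rho>"
    define \<P> where "\<P> = patches \<Lambda> ?V \<rho>"
    define \<nu> where "\<nu> = patch_frequency \<Lambda> ?V \<rho>"
    have finQ: "finite Q" unfolding Q_def sv_def by (rule finite_sieved_translates[OF lat])
    have finB: "finite B" unfolding B_def by (rule finite_lattice_ball[OF lat])
    have fin\<P>: "finite \<P>" unfolding \<P>_def by (rule finite_patches[OF lat V])
    have "Q \<noteq> {}" using lattice_zero[OF lat] by (auto simp: Q_def)
    then have cardQ: "real (card Q) > 0" using finQ by (simp add: card_gt_0_iff)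
    have \<nu>: "has_density (patch_locations \<Lambda> ?V \<rho> P) (\<nu> P)" for P
      using patch_locations_density[OF lat k nk \<rho>] density_eq
      unfolding \<nu>_def patch_frequency_def by metis
    have \<nu>_nonneg: "\<nu> P \<ge> 0" for P using \<nu> by (rule density_nonneg)
    \<comment> \<open>\<open>missing\<close> depends on the location and not only on the patch, so each patch is coded at a location
      where it is smallest; this makes the code length a lower bound at all its other locations.\<close>
    have "\<exists>t. (t \<in> \<Lambda> \<and> patch ?V \<rho> t = P) \<and>
        (\<forall>t'. t' \<in> \<Lambda> \<and> patch ?V \<rho> t' = P \<longrightarrow> card (missing k \<Lambda> N \<rho> t) \<le> card (missing k \<Lambda> N \<rho> t'))"
      if P: "P \<in> \<P>" for P
    proof -
      obtain t where "t \<in> \<Lambda> \<and> patch ?V \<rho> t = P" using P unfolding \<P>_def patches_def by blast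
      then show ?thesis by (rule ex_has_least_nat)
    qed
    then obtain \<tau> where \<tau>: "\<And>P. P \<in> \<P> \<Longrightarrow> \<tau> P \<in> \<Lambda>" "\<And>P. P \<in> \<P> \<Longrightarrow> patch ?V \<rho> (\<tau> P) = P"
      "\<And>P t. P \<in> \<P> \<Longrightarrow> t \<in> \<Lambda> \<Longrightarrow> patch ?V \<rho> t = P \<Longrightarrow>
         card (missing k \<Lambda> N \<rho> (\<tau> P)) \<le> card (missing k \<Lambda> N \<rho> t)"
      by metis
    \<comment> \<open>The total weight of all codes: a translate from \<open>Q\<close> together with
      an arbitrary subset of \<open>B\<close>.\<close>
    define Z where "Z = real (card Q) * (1 + \<epsilon>) ^ card B"
    have Z: "Z > 0" using cardQ \<epsilon> by (simp add: Z_def)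
    define q where "q P = \<epsilon> ^ card (missing k \<Lambda> N \<rho> (\<tau> P)) / Z" for P
    have q_pos: "q P > 0" for P using \<epsilon> Z by (simp add: q_def)
    have q_sum: "(\<Sum>P\<in>\<P>. q P) \<le> 1"
    proof -
      \<comment> \<open>A patch is recovered from its code, so distinct patches have distinct codes
        and the sum over patches is part of the sum over all pairs.\<close>
      define code where "code P = (sv (\<tau> P), missing k \<Lambda> N \<rho> (\<tau> P))" for P
      have decode: "P = (fst (code P) \<inter> ball 0 \<rho>) - snd (code P)" if "P \<in> \<P>" for P
      proof -
        have "P = patch (sieved k \<Lambda> N) \<rho> (\<tau> P) - missing k \<Lambda> N \<rho> (\<tau> P)"
          using patch_k_free_points[OF lat k N \<tau>(1)[OF that], of \<rho>] \<tau>(2)[OF that] by simp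
        moreover have "patch (sieved k \<Lambda> N) \<rho> (\<tau> P) = sv (\<tau> P) \<inter> ball 0 \<rho>"
          by (auto simp: patch_iff sv_def)
        ultimately show ?thesis by (simp add: code_def)
      qed
      have "inj_on code \<P>" by (rule inj_onI) (metis decode)
      moreover have "code ` \<P> \<subseteq> Q \<times> Pow B"
        using \<tau>(1) by (auto simp: code_def Q_def B_def missing_def)
      ultimately have "(\<Sum>P\<in>\<P>. \<epsilon> ^ card (snd (code P))) \<le> (\<Sum>x\<in>Q \<times> Pow B. \<epsilon> ^ card (snd x))"
        using finQ finB \<epsilon>
        by (subst sum.reindex[of code \<P> "\<lambda>x. \<epsilon> ^ card (snd x)", unfolded comp_def, symmetric])
           (auto intro!: sum_mono2)
      also have "\<dots> = (\<Sum>A\<in>Q. \<Sum>S\<in>Pow B. \<epsilon> ^ card S)"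
        unfolding sum.cartesian_product by (simp only: case_prod_unfold)
      also have "\<dots> = Z"
        using sum_power_card_Pow[OF finB, of \<epsilon>] by (simp add: Z_def)
      finally have "(\<Sum>P\<in>\<P>. \<epsilon> ^ card (snd (code P))) / Z \<le> 1" using Z by simp
      then show ?thesis by (simp add: q_def code_def sum_divide_distrib)
    qed
    define \<kappa> where "\<kappa> = ln (1 / \<epsilon>)"
    have \<kappa>: "\<kappa> \<ge> 0" using \<epsilon> by (simp add: \<kappa>_def)
    have ln_q: "- ln (q P) = \<kappa> * real (card (missing k \<Lambda> N \<rho> (\<tau> P))) + ln Z" for P
      using \<epsilon> Z by (simp add: q_def \<kappa>_def ln_div ln_realpow)
    have ln_Z: "ln Z = ln (card Q) + real (card B) * ln (1 + \<epsilon>)"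
      using cardQ \<epsilon> by (simp add: Z_def ln_mult ln_realpow)
    \<comment> \<open>The added \<open>1\<close> makes \<open>?b\<close> strictly larger than the
      limiting mean.\<close>
    let ?b = "real (card B) * C / real N + 1"
    let ?avg = "\<lambda>R. (\<Sum>t\<in>\<Lambda> \<inter> ball 0 R. real (card (missing k \<Lambda> N \<rho> t))) / (R ^ ?n * ?v)"
    \<comment> \<open>For finite \<open>R\<close> both sides are averages over lattice points, and
      the minimality of \<open>\<tau>\<close> replaces the missing set at the chosen location by the
      one at the current location; then \<open>R\<close> tends to infinity.\<close>
    have "(\<Sum>P\<in>\<P>. \<nu> P * - ln (q P)) \<le> \<kappa> * ?b + ln Z * d"
    proof (rule tendsto_le)
      show "((\<lambda>R. \<Sum>P\<in>\<P>. normalized_count (patch_locations \<Lambda> ?V \<rho> P) R * - ln (q P))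
          \<longlongrightarrow> (\<Sum>P\<in>\<P>. \<nu> P * - ln (q P))) at_top"
        using \<nu> by (intro tendsto_sum tendsto_mult tendsto_const) (simp add: has_density_iff)
      show "((\<lambda>R. \<kappa> * ?b + ln Z * normalized_count \<Lambda> R) \<longlongrightarrow> \<kappa> * ?b + ln Z * d) at_top"
        using d by (intro tendsto_add tendsto_mult tendsto_const) (simp add: has_density_iff)
      have "\<forall>\<^sub>F R in at_top. ?avg R \<le> ?b"
        using C(2)[OF N \<rho>, of ?b] by (simp add: B_def)
      then show "\<forall>\<^sub>F R in at_top. (\<Sum>P\<in>\<P>. normalized_count (patch_locations \<Lambda> ?V \<rho> P) R * - ln (q P))
          \<le> \<kappa> * ?b + ln Z * normalized_count \<Lambda> R"
        using eventually_gt_at_top[of 0]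
      proof eventually_elim
        case (elim R)
        have "(\<Sum>P\<in>\<P>. normalized_count (patch_locations \<Lambda> ?V \<rho> P) R * - ln (q P))
            = (\<Sum>t\<in>\<Lambda> \<inter> ball 0 R. - ln (q (patch ?V \<rho> t))) / (R ^ ?n * ?v)"
          unfolding \<P>_def by (rule sum_patches_normalized_count[OF lat V])
        also have "\<dots> \<le> (\<Sum>t\<in>\<Lambda> \<inter> ball 0 R. \<kappa> * real (card (missing k \<Lambda> N \<rho> t)) + ln Z) / (R ^ ?n * ?v)"
        proof (intro divide_right_mono sum_mono)
          fix t assume "t \<in> \<Lambda> \<inter> ball 0 R"
          then have "card (missing k \<Lambda> N \<rho> (\<tau> (patch ?V \<rho> t))) \<le> card (missing k \<Lambda> N \<rho> t)"
            by (intro \<tau>(3)) (auto simp: \<P>_def patches_def)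
          then show "- ln (q (patch ?V \<rho> t)) \<le> \<kappa> * real (card (missing k \<Lambda> N \<rho> t)) + ln Z"
            unfolding ln_q using \<kappa> by (intro add_right_mono mult_left_mono) auto
        qed (use elim v in auto)
        also have "\<dots> = \<kappa> * ?avg R + ln Z * normalized_count \<Lambda> R"
          by (simp add: sum.distrib sum_distrib_left[symmetric] add_divide_distrib normalized_count_def)
        also have "\<dots> \<le> \<kappa> * ?b + ln Z * normalized_count \<Lambda> R"
          using elim(1) \<kappa> by (intro add_right_mono mult_left_mono)
        finally show ?case .
      qed
    qed simp
    then have "(\<Sum>P\<in>\<P>. - \<nu> P * ln (\<nu> P)) \<le> \<kappa> * ?b + ln Z * d + 1"
      using entropy_le_cross_entropy[of \<P> \<nu> q] \<nu>_nonneg q_pos q_sum by fastforce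
    \<comment> \<open>Only here is the witness for \<open>K\<close> determined, as the logarithm of
      the number of translates. It is spelled out because the local names are introduced after
      \<open>\<rho>\<close> and \<open>\<epsilon>\<close>, on which it must not depend.\<close>
    then show "(\<Sum>P\<in>patches \<Lambda> ?V \<rho>. - patch_frequency \<Lambda> ?V \<rho> P * ln (patch_frequency \<Lambda> ?V \<rho> P))
       \<le> ln (1 / \<epsilon>) * (real (card (\<Lambda> \<inter> ball 0 \<rho>)) * C / real N + 1)
          + (ln (card ((\<lambda>t. {x. x + t \<in> sieved k \<Lambda> N}) ` \<Lambda>))
             + real (card (\<Lambda> \<inter> ball 0 \<rho>)) * ln (1 + \<epsilon>)) * d + 1"
      unfolding ln_Z \<P>_def \<nu>_def \<kappa>_def B_def Q_def sv_def .
  qed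
  then show thesis using that[OF C(1)] by blast
qed

text \<open>Every lattice point is the location of exactly one patch; this is the averaging identity
  with constant weight \<open>1\<close>.\<close>

lemma sum_patch_frequency:
  fixes \<Lambda> :: "(real^'n) set"
  assumes lat: "is_lattice \<Lambda>" and V: "V \<subseteq> \<Lambda>" and d: "has_density \<Lambda> d"
    and ex: "\<And>P. P \<in> patches \<Lambda> V \<rho> \<Longrightarrow> \<exists>e. has_density (patch_locations \<Lambda> V \<rho> P) e"
  shows "(\<Sum>P\<in>patches \<Lambda> V \<rho>. patch_frequency \<Lambda> V \<rho> P) = d"
proof -
  have "((\<lambda>R. \<Sum>P\<in>patches \<Lambda> V \<rho>. normalized_count (patch_locations \<Lambda> V \<rho> P) R * 1)
      \<longlongrightarrow> (\<Sum>P\<in>patches \<Lambda> V \<rho>. patch_frequency \<Lambda> V \<rho> P * 1)) at_top"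
  proof (intro tendsto_sum tendsto_mult tendsto_const)
    fix P assume "P \<in> patches \<Lambda> V \<rho>"
    then show "(normalized_count (patch_locations \<Lambda> V \<rho> P) \<longlongrightarrow> patch_frequency \<Lambda> V \<rho> P) at_top"
      using ex density_eq unfolding patch_frequency_def has_density_iff[symmetric] by metis
  qed
  moreover have "(\<lambda>R. \<Sum>P\<in>patches \<Lambda> V \<rho>. normalized_count (patch_locations \<Lambda> V \<rho> P) R * 1)
      = normalized_count \<Lambda>"
    unfolding sum_patches_normalized_count[OF lat V] by (simp add: normalized_count_def fun_eq_iff)
  ultimately have "has_density \<Lambda> (\<Sum>P\<in>patches \<Lambda> V \<rho>. patch_frequency \<Lambda> V \<rho> P)"
    unfolding has_density_iff by simp
  then show ?thesis using has_density_unique d by blast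
qed

text \<open>Each frequency is at most their sum \<open>d\<close>, so a positive one has logarithm at
  most \<open>\<bar>ln d\<bar>\<close>. The bound does not involve \<open>\<rho>\<close> and
  vanishes after division by the volume.\<close>

lemma patch_entropy_lower_bound:
  fixes \<Lambda> :: "(real^'n) set"
  assumes lat: "is_lattice \<Lambda>" and V: "V \<subseteq> \<Lambda>" and d: "has_density \<Lambda> d"
    and ex: "\<And>P. P \<in> patches \<Lambda> V \<rho> \<Longrightarrow> \<exists>e. has_density (patch_locations \<Lambda> V \<rho> P) e"
  shows "- (d * \<bar>ln d\<bar>)
    \<le> (\<Sum>P\<in>patches \<Lambda> V \<rho>. - patch_frequency \<Lambda> V \<rho> P * ln (patch_frequency \<Lambda> V \<rho> P))"
proof -
  let ?\<nu> = "patch_frequency \<Lambda> V \<rho>" and ?\<P> = "patches \<Lambda> V \<rho>"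
  have sum: "(\<Sum>P\<in>?\<P>. ?\<nu> P) = d" by (rule sum_patch_frequency[OF lat V d ex])
  have nonneg: "?\<nu> P \<ge> 0" if "P \<in> ?\<P>" for P
    using ex[OF that] density_eq density_nonneg unfolding patch_frequency_def by metis
  have term_le: "?\<nu> P * - \<bar>ln d\<bar> \<le> - ?\<nu> P * ln (?\<nu> P)" if P: "P \<in> ?\<P>" for P
  proof (cases "?\<nu> P = 0")
    case False
    then have pos: "?\<nu> P > 0" using nonneg[OF P] by simp
    have "?\<nu> P \<le> d"
      unfolding sum[symmetric] using finite_patches[OF lat V] nonneg P by (intro member_le_sum) auto
    then have "ln (?\<nu> P) \<le> \<bar>ln d\<bar>" using pos ln_mono[of "?\<nu> P" d] by linarith
    then show ?thesis using pos by simp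
  qed simp
  have "- (d * \<bar>ln d\<bar>) = (\<Sum>P\<in>?\<P>. ?\<nu> P * - \<bar>ln d\<bar>)"
    unfolding sum_distrib_right[symmetric] sum by simp
  also have "\<dots> \<le> (\<Sum>P\<in>?\<P>. - ?\<nu> P * ln (?\<nu> P))" using term_le by (rule sum_mono)
  finally show ?thesis .
qed

text \<open>After division by the volume the lower bound tends to \<open>0\<close>, and the upper
  bound tends to \<open>ln (1 / \<epsilon>) * d * C / N + d * d * ln (1 + \<epsilon>)\<close>, which
  is made small by choosing \<open>\<epsilon>\<close> and then \<open>N\<close>.\<close>

lemma patch_entropy_tendsto_0:
  fixes \<Lambda> :: "(real^'n) set"
  assumes lat: "is_lattice \<Lambda>" and k: "k \<ge> 1" and nk: "CARD('n) * k \<ge> 2"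
  defines "V \<equiv> k_free_points k \<Lambda>"
  shows "((\<lambda>\<rho>. (\<Sum>P\<in>patches \<Lambda> V \<rho>. - patch_frequency \<Lambda> V \<rho> P * ln (patch_frequency \<Lambda> V \<rho> P))
      / (\<rho> ^ CARD('n) * unit_ball_vol (real CARD('n)))) \<longlongrightarrow> 0) at_top"
proof -
  let ?v = "unit_ball_vol (real CARD('n))"
  define D where "D \<rho> = \<rho> ^ CARD('n) * ?v" for \<rho>
  define F where "F \<rho> = (\<Sum>P\<in>patches \<Lambda> V \<rho>. - patch_frequency \<Lambda> V \<rho> P
    * ln (patch_frequency \<Lambda> V \<rho> P))" for \<rho>
  have D_pos: "D \<rho> > 0" if "\<rho> > 0" for \<rho> using that by (simp add: D_def)
  have D_inv: "((\<lambda>\<rho>. 1 / D \<rho>) \<longlongrightarrow> 0) at_top"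
  proof -
    have "((\<lambda>\<rho>. inverse \<rho> ^ CARD('n) * (1 / ?v)) \<longlongrightarrow> 0 ^ CARD('n) * (1 / ?v)) at_top"
      by (intro tendsto_mult tendsto_power tendsto_const tendsto_inverse_0_at_top filterlim_ident)
    then show ?thesis by (simp add: D_def inverse_eq_divide power_divide zero_power)
  qed
  obtain d where d: "has_density \<Lambda> d" using lattice_density[OF lat] by blast
  have d0: "d \<ge> 0" by (rule density_nonneg[OF d])
  have V: "V \<subseteq> \<Lambda>" by (auto simp: V_def k_free_points_def)
  define m where "m \<rho> = real (card (\<Lambda> \<inter> ball 0 \<rho>))" for \<rho>
  have m_lim: "((\<lambda>\<rho>. m \<rho> / D \<rho>) \<longlongrightarrow> d) at_top"
    using d by (simp add: has_density_iff normalized_count_def[abs_def] m_def D_def)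
  obtain C where C: "C > 0"
    "\<And>N. N \<ge> 1 \<Longrightarrow> \<exists>K. \<forall>\<rho>>0. \<forall>\<epsilon>. 0 < \<epsilon> \<and> \<epsilon> < 1 \<longrightarrow>
       F \<rho> \<le> ln (1 / \<epsilon>) * (m \<rho> * C / real N + 1) + (K + m \<rho> * ln (1 + \<epsilon>)) * d + 1"
    using patch_entropy_bound[OF lat k nk d] unfolding F_def V_def m_def by blast
  have "((\<lambda>\<rho>. F \<rho> / D \<rho>) \<longlongrightarrow> 0) at_top"
  proof (rule order_tendstoI)
    fix r :: real assume r: "r < 0"
    have "((\<lambda>\<rho>. - (d * \<bar>ln d\<bar>) * (1 / D \<rho>)) \<longlongrightarrow> - (d * \<bar>ln d\<bar>) * 0) at_top"
      by (intro tendsto_mult tendsto_const D_inv)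
    then have "\<forall>\<^sub>F \<rho> in at_top. r < - (d * \<bar>ln d\<bar>) * (1 / D \<rho>)"
      using r by (intro order_tendstoD(1)) auto
    then show "\<forall>\<^sub>F \<rho> in at_top. r < F \<rho> / D \<rho>"
      using eventually_gt_at_top[of 0]
    proof eventually_elim
      case (elim \<rho>)
      have "- (d * \<bar>ln d\<bar>) \<le> F \<rho>"
        unfolding F_def
        by (rule patch_entropy_lower_bound[OF lat V d])
           (use patch_locations_density[OF lat k nk elim(2)] V_def in simp)
      then have "- (d * \<bar>ln d\<bar>) / D \<rho> \<le> F \<rho> / D \<rho>"
        using D_pos[OF elim(2)] by (intro divide_right_mono) auto
      then show ?case using elim(1) by simp
    qed
  next
    fix r :: real assume r: "r > 0"
    \<comment> \<open>With \<open>ln (1 + \<epsilon>) \<le> \<epsilon>\<close> the second part of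
      the limit is at most \<open>r / 2\<close>. The denominator \<open>d\<^sup>2 + 1\<close> is
      positive even for \<open>d = 0\<close>.\<close>
    define \<epsilon> where "\<epsilon> = min (1 / 2) (r / 2 / (d\<^sup>2 + 1))"
    have d2: "d\<^sup>2 + 1 > 0" by (simp add: add_nonneg_pos)
    then have \<epsilon>: "0 < \<epsilon>" "\<epsilon> < 1" using r by (auto simp: \<epsilon>_def)
    have "d * d * ln (1 + \<epsilon>) \<le> d * d * \<epsilon>"
      using \<epsilon> ln_add_one_self_le_self[of \<epsilon>] by (intro mult_left_mono) auto
    also have "\<dots> \<le> (d\<^sup>2 + 1) * \<epsilon>" using \<epsilon> by (simp add: power2_eq_square distrib_right)
    also have "\<dots> \<le> (d\<^sup>2 + 1) * (r / 2 / (d\<^sup>2 + 1))"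
      using d2 by (intro mult_left_mono) (auto simp: \<epsilon>_def)
    also have "\<dots> = r / 2"
      unfolding times_divide_eq_right[of _ "r / 2"]
      by (rule nonzero_mult_div_cancel_left) (use d2 in linarith)
    finally have part1: "d * d * ln (1 + \<epsilon>) \<le> r / 2" .
    let ?\<kappa> = "ln (1 / \<epsilon>)"
    \<comment> \<open>With \<open>\<epsilon>\<close> fixed, \<open>N\<close> is taken so large that
      the first part of the limit is below \<open>r / 2\<close>.\<close>
    obtain N where N: "real N > \<bar>?\<kappa> * d * C\<bar> / (r / 2)" using reals_Archimedean2 by blast
    have "\<bar>?\<kappa> * d * C\<bar> / (r / 2) \<ge> 0" using r by simp
    then have N_pos: "real N > 0" using N by linarith
    have "?\<kappa> * d * C < real N * (r / 2)" using N r by (simp add: pos_divide_less_eq)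
    then have part2: "?\<kappa> * (d * C / real N) < r / 2"
      using N_pos by (simp add: pos_divide_less_eq mult.commute mult.left_commute)
    have "N \<ge> 1" using N_pos by simp
    from C(2)[OF this] obtain K where K: "\<And>\<rho>. \<rho> > 0 \<Longrightarrow>
       F \<rho> \<le> ?\<kappa> * (m \<rho> * C / real N + 1) + (K + m \<rho> * ln (1 + \<epsilon>)) * d + 1"
      using \<epsilon> by blast
    \<comment> \<open>Terms proportional to \<open>m \<rho>\<close> converge since
      \<open>m \<rho> / D \<rho>\<close> tends to \<open>d\<close>; the constant ones, including
      \<open>K\<close>, vanish.\<close>
    have "((\<lambda>\<rho>. ?\<kappa> * (m \<rho> / D \<rho> * (C / real N) + 1 / D \<rho>)
          + (K * (1 / D \<rho>) + m \<rho> / D \<rho> * ln (1 + \<epsilon>)) * d + 1 / D \<rho>)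
        \<longlongrightarrow> ?\<kappa> * (d * (C / real N) + 0) + (K * 0 + d * ln (1 + \<epsilon>)) * d + 0) at_top"
      by (intro tendsto_add tendsto_mult tendsto_const m_lim D_inv)
    moreover have "?\<kappa> * (d * (C / real N) + 0) + (K * 0 + d * ln (1 + \<epsilon>)) * d + 0
        = ?\<kappa> * (d * C / real N) + d * d * ln (1 + \<epsilon>)"
      by (simp add: mult.commute mult.left_commute)
    then have "?\<kappa> * (d * (C / real N) + 0) + (K * 0 + d * ln (1 + \<epsilon>)) * d + 0 < r"
      using part1 part2 by linarith
    ultimately have "\<forall>\<^sub>F \<rho> in at_top. ?\<kappa> * (m \<rho> / D \<rho> * (C / real N) + 1 / D \<rho>)
          + (K * (1 / D \<rho>) + m \<rho> / D \<rho> * ln (1 + \<epsilon>)) * d + 1 / D \<rho> < r"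
      by (rule order_tendstoD(2))
    then show "\<forall>\<^sub>F \<rho> in at_top. F \<rho> / D \<rho> < r"
      using eventually_gt_at_top[of 0]
    proof eventually_elim
      case (elim \<rho>)
      have "F \<rho> / D \<rho> \<le> (?\<kappa> * (m \<rho> * C / real N + 1) + (K + m \<rho> * ln (1 + \<epsilon>)) * d + 1) / D \<rho>"
        using K[OF elim(2)] D_pos[OF elim(2)] by (intro divide_right_mono) auto
      also have "\<dots> = ?\<kappa> * (m \<rho> / D \<rho> * (C / real N) + 1 / D \<rho>)
          + (K * (1 / D \<rho>) + m \<rho> / D \<rho> * ln (1 + \<epsilon>)) * d + 1 / D \<rho>"
        by (simp add: divide_inverse algebra_simps)
      also note elim(1)
      finally show ?case .
    qed
  qed
  then show ?thesis by (simp add: F_def D_def)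
qed

theorem theorem4:
  fixes \<Lambda> :: "(real^'n) set" and k :: nat
  assumes "is_lattice \<Lambda>"
    and "lattice_det \<Lambda> = 1"
    and "k \<ge> 1"
    and "CARD('n) = 1 \<longrightarrow> k \<ge> 2"
  shows "has_measure_entropy \<Lambda> (k_free_points k \<Lambda>) 0"
proof -
  let ?V = "k_free_points k \<Lambda>"
  \<comment> \<open>The two assumptions on \<open>k\<close> together exclude exactly the divergent
    case \<open>n = k = 1\<close>.\<close>
  have nk: "CARD('n) * k \<ge> 2"
  proof (cases "CARD('n) = 1")
    case True
    then show ?thesis using assms(4) by simp
  next
    case False
    then have "CARD('n) \<ge> 2" using zero_less_card_finite[where 'a = 'n] by linarith
    then show ?thesis using mult_le_mono[of 2 "CARD('n)" 1 k] assms(3) by simp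
  qed
  \<comment> \<open>The factor \<open>1 / ln 2\<close> converts natural logarithms to base
    \<open>2\<close>.\<close>
  have "((\<lambda>\<rho>. 1 / ln 2 * ((\<Sum>P\<in>patches \<Lambda> ?V \<rho>. - patch_frequency \<Lambda> ?V \<rho> P
        * ln (patch_frequency \<Lambda> ?V \<rho> P)) / (\<rho> ^ CARD('n) * unit_ball_vol (real CARD('n)))))
      \<longlongrightarrow> 1 / ln 2 * 0) at_top"
    by (intro tendsto_mult tendsto_const patch_entropy_tendsto_0 assms nk)
  moreover have "1 / ln 2 * ((\<Sum>P\<in>patches \<Lambda> ?V \<rho>. - patch_frequency \<Lambda> ?V \<rho> P
        * ln (patch_frequency \<Lambda> ?V \<rho> P)) / (\<rho> ^ CARD('n) * unit_ball_vol (real CARD('n))))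
      = 1 / (\<rho> ^ CARD('n) * unit_ball_vol (real CARD('n))) *
          (\<Sum>P\<in>patches \<Lambda> ?V \<rho>.
             - patch_frequency \<Lambda> ?V \<rho> P * log 2 (patch_frequency \<Lambda> ?V \<rho> P))" for \<rho>
    by (simp add: log_def sum_divide_distrib[symmetric] sum_negf mult.commute)
  ultimately show ?thesis
    unfolding has_measure_entropy_def
    using patch_locations_density[OF assms(1,3) nk] by simp
qed

end
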